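(* There exists a universal constant $C$ such that the following holds. Let $s\in S$ be fixed and let $\mathscr{B}(j)=\mathcal{B}(s,2^{-j})$ for $j\in\mathbb{N}$. Assume the following. (i) There is a nonincreasing function $D:(0,1/4]\to[1,+\infty)$ such that, for every $x\in(0,1/4]$, every closed ball $B\subset S$ of radius $4x$ and every $x$-separated subset $N$ of $B$, one has $|N|\le\exp[D(x)]$. (ii) There are a nondecreasing function $\beta:\mathbb{N}\to[1,+\infty)$ and a number $\gamma\in[1,4]$ such that $$\nu(\mathscr{B}(j-k))\le\exp\left[\gamma^{k}\beta(j)\right]\nu(\mathscr{B}(j))\quad\text{for all integers } j\ge3 \text{ and } 3\le k\le j.$$ (iii) The sample size $n$ and the integer $J_1(n)$ satisfy $$J_1(n)\ge3\qquad\text{and}\qquad4^{-J_1(n)-1}n\ge\max\left\{\gamma^{3}\beta(J_1(n))/3,\ D\left(2^{1-J_1(n)}\right),\ \kappa\right\}$$ for some constant $\kappa>1$. (iv) The observations $X_i$ are i.i.d. with a distribution $P$ such that $$\frac{1}{\nu\left(\mathscr{B}(J_1(n))\right)}\int_{\mathscr{B}(J_1(n))}K\left(P,P_t\right)d\nu(t)=K_n<+\infty.$$ (v) The loss function is $w\circ h$, where the function $w$ satisfies, for some positive constants $\delta,a',B'$ with $B'\le(\kappa-1)/4$, $w(0)=0$ and $$x^\delta w(z)\le w(xz)\le a'\exp\left[B'x^2\right]w(z)\quad\text{for all } z\in(0,1/2] \text{ and } 2\le x\le z^{-1}.$$ Consider a Bayes estimator $P_{\widetilde{s}}$ of $P$,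 where $\widetilde{s}=\widetilde{s}(\mathbf{X})$ is a minimizer over $S$ of the function $u\mapsto\mathbb{E}\left[w(h(u,\mathbf{t}))|\mathbf{X}\right]$. Then $$\mathbb{E}\left[h^2\left(\widetilde{s}(\mathbf{X}),s\right)\right]\le C\Delta^2\left(4^{-J_1(n)}+K_n\right)\quad\text{with }\ \Delta=4\left(\left[(5/4)(1+a'/2)\right]^{1/\delta}+1\right).$$
   Context: $\mathbb{N}=\{0,1,2,\dots\}$. $\mathbf{X}=(X_1,\dots,X_n)$ is a sample of $n$ i.i.d. random variables with values in a measurable space $\mathscr{X}$ and common distribution $P$; $\mathbb{E}$ (unconditional) is expectation when $\mathbf{X}$ has distribution $P^{\otimes n}$. The Hellinger distance $h$ between probabilities $R,T$ on $\mathscr{X}$ is given by $h^2(R,T)=\frac12\int\left(\sqrt{dR/d\lambda}-\sqrt{dT/d\lambda}\right)^2d\lambda$, where $\lambda$ is any positive measure dominating $R$ and $T$ (so $h\le 1$). The Kullback-Leibler divergence is $K(P,Q)=\int\log(dP/dQ)\,dP\in[0,+\infty]$ if $P\ll Q$ and $K(P,Q)=+\infty$ otherwise. The model is a family $\{P_t\,|\,t\in S\}$ of probabilities on $\mathscr{X}$ with densities $f_t=dP_t/d\mu$ with respect to a reference measure $\mu$; the map $t\mapsto P_t$ is one-to-one, and $S$ is regarded as a metric space with distance $h(t,u)=h(P_t,P_u)$ and its Borel $\sigma$-algebra. The true distribution $P$ need not belong to the model, and the fixed point $s\in S$ is arbitrary (it may or may not satisfy $P=P_s$). $\mathcal{B}(t,r)$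 denotes the closed ball in $(S,h)$ with center $t$ and radius $r$. For $x>0$, a subset $N$ of a metric space is called $x$-separated if any two distinct points of $N$ are at distance larger than $x$; $|N|$ is the cardinality of $N$. The prior $\nu$ is a probability on $S$, which turns the parameter into a random variable $\mathbf{t}$ with values in $S$. For $\mathbf{x}=(x_1,\dots,x_n)\in\mathscr{X}^n$, $f_t(\mathbf{x})=\prod_{i=1}^nf_t(x_i)$. The posterior distribution of $\mathbf{t}$ is $\overline{\nu}(A|\mathbf{X})=\int_Af_t(\mathbf{X})\,d\nu(t)\big/\int_Sf_t(\mathbf{X})\,d\nu(t)$ for measurable $A\subset S$, and $\mathbb{E}[w(h(u,\mathbf{t}))|\mathbf{X}]=\int_Sw(h(u,t))\,d\overline{\nu}(t|\mathbf{X})$. If the minimizer $\widetilde{s}$ is not unique, it is any minimizer.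
   Formalization: The function w is assumed not identically zero on [0,1] (for w = 0 every point of S is a minimizer and the bound fails); measurability of w, of the estimator and joint measurability of (t,x) ↦ f_t(x) are explicit; C is stated per pair of ambient sets, uniformity follows by embedding. *)

theory Defs
  imports "HOL-Probability.Probability"
begin

definition sum_measure :: "'x measure \<Rightarrow> 'x measure \<Rightarrow> 'x measure" where
  "sum_measure R T = measure_of (space R) (sets R) (\<lambda>A. emeasure R A + emeasure T A)"

(* The dominating measure is taken to be R + T; hellinger_density below shows that any other
   sigma-finite dominating measure gives the same value. *)
definition hellinger :: "'x measure \<Rightarrow> 'x measure \<Rightarrow> real" where
  "hellinger R T = (let L = sum_measure R T in
     sqrt (1 / 2 * (\<integral>x. (sqrt (enn2real (RN_deriv L R x)) - sqrt (enn2real (RN_deriv L T x)))\<^sup>2 \<partial>L)))"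

(* KL_divergence b Q P is the integral of log b (dP/dQ) with respect to P, and it is 0 when that
   integrand is not integrable. For probabilities with P absolutely continuous with respect to Q
   the negative part is always integrable, so non-integrability means that the integral is
   +infinity. *)
definition kullback :: "'x measure \<Rightarrow> 'x measure \<Rightarrow> ennreal" where
  "kullback P Q =
     (if absolutely_continuous Q P \<and> integrable P (entropy_density (exp 1) Q P)
      then ennreal (KL_divergence (exp 1) Q P) else \<infinity>)"

definition model_dist :: "'x measure \<Rightarrow> ('s \<Rightarrow> 'x \<Rightarrow> real) \<Rightarrow> 's \<Rightarrow> 'x measure" where
  "model_dist \<mu> f t = density \<mu> (\<lambda>x. ennreal (f t x))"

definition hdist :: "'x measure \<Rightarrow> ('s \<Rightarrow> 'x \<Rightarrow> real) \<Rightarrow> 's \<Rightarrow> 's \<Rightarrow> real" where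
  "hdist \<mu> f t u = hellinger (model_dist \<mu> f t) (model_dist \<mu> f u)"

abbreviation hball :: "'x measure \<Rightarrow> ('s \<Rightarrow> 'x \<Rightarrow> real) \<Rightarrow> 's set \<Rightarrow> 's \<Rightarrow> real \<Rightarrow> 's set" where
  "hball \<mu> f S \<equiv> Metric_space.mcball S (hdist \<mu> f)"

definition hborel :: "'x measure \<Rightarrow> ('s \<Rightarrow> 'x \<Rightarrow> real) \<Rightarrow> 's set \<Rightarrow> 's measure" where
  "hborel \<mu> f S = sigma S {U. openin (Metric_space.mtopology S (hdist \<mu> f)) U}"

definition separated :: "('s \<Rightarrow> 's \<Rightarrow> real) \<Rightarrow> real \<Rightarrow> 's set \<Rightarrow> bool" where
  "separated d x N \<longleftrightarrow> (\<forall>t\<in>N. \<forall>u\<in>N. t \<noteq> u \<longrightarrow> d t u > x)"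

(* Joint measurability of the densities is what makes the posterior a random probability. *)
locale bayes_model =
  fixes \<mu> :: "'x measure" and S :: "'s set" and f :: "'s \<Rightarrow> 'x \<Rightarrow> real" and \<nu> :: "'s measure"
  assumes density_nonneg: "t \<in> S \<Longrightarrow> x \<in> space \<mu> \<Longrightarrow> 0 \<le> f t x"
    and prob_model: "t \<in> S \<Longrightarrow> prob_space (model_dist \<mu> f t)"
    and inj_model: "inj_on (model_dist \<mu> f) S"
    and joint_measurable: "(\<lambda>(t, x). f t x) \<in> borel_measurable (hborel \<mu> f S \<Otimes>\<^sub>M \<mu>)"
    and prob_prior: "prob_space \<nu>"
    and sets_prior: "sets \<nu> = sets (hborel \<mu> f S)"

definition likelihood :: "('s \<Rightarrow> 'x \<Rightarrow> real) \<Rightarrow> nat \<Rightarrow> 's \<Rightarrow> (nat \<Rightarrow> 'x) \<Rightarrow> ennreal" where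
  "likelihood f n t x = (\<Prod>i<n. ennreal (f t (x i)))"

definition posterior :: "('s \<Rightarrow> 'x \<Rightarrow> real) \<Rightarrow> 's measure \<Rightarrow> nat \<Rightarrow> (nat \<Rightarrow> 'x) \<Rightarrow> 's measure" where
  "posterior f \<nu> n x =
     density \<nu> (\<lambda>t. likelihood f n t x / (\<integral>\<^sup>+ t'. likelihood f n t' x \<partial>\<nu>))"

definition posterior_risk ::
  "'x measure \<Rightarrow> ('s \<Rightarrow> 'x \<Rightarrow> real) \<Rightarrow> 's measure \<Rightarrow> (real \<Rightarrow> real) \<Rightarrow> nat \<Rightarrow> (nat \<Rightarrow> 'x) \<Rightarrow> 's \<Rightarrow> real" where
  "posterior_risk \<mu> f \<nu> w n x u = (\<integral>t. w (hdist \<mu> f u t) \<partial>posterior f \<nu> n x)"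

(* The minimality is required almost surely only: the posterior is defined only for samples at
   which the normalizing integral is positive and finite. *)
definition bayes_estimator ::
  "'x measure \<Rightarrow> 's set \<Rightarrow> ('s \<Rightarrow> 'x \<Rightarrow> real) \<Rightarrow> 's measure \<Rightarrow> (real \<Rightarrow> real) \<Rightarrow> 'x measure \<Rightarrow> nat
     \<Rightarrow> ((nat \<Rightarrow> 'x) \<Rightarrow> 's) \<Rightarrow> bool" where
  "bayes_estimator \<mu> S f \<nu> w P n est \<longleftrightarrow>
     est \<in> measurable (Pi\<^sub>M {..<n} (\<lambda>_. P)) (hborel \<mu> f S) \<and>
     (AE x in Pi\<^sub>M {..<n} (\<lambda>_. P). is_arg_min (posterior_risk \<mu> f \<nu> w n x) (\<lambda>u. u \<in> S) (est x))"

lemma space_sum_measure [simp]: "space (sum_measure R T) = space R"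
  and sets_sum_measure [simp]: "sets (sum_measure R T) = sets R"
  by (simp_all add: sum_measure_def)

lemma emeasure_sum_measure:
  assumes "sets R = sets T" "A \<in> sets R"
  shows "emeasure (sum_measure R T) A = emeasure R A + emeasure T A"
  unfolding sum_measure_def
proof (rule emeasure_measure_of_sigma)
  show "sigma_algebra (space R) (sets R)" by (rule sets.sigma_algebra_axioms)
  show "positive (sets R) (\<lambda>A. emeasure R A + emeasure T A)" by (simp add: positive_def)
  show "countably_additive (sets R) (\<lambda>A. emeasure R A + emeasure T A)"
  proof (rule countably_additiveI)
    fix A :: "nat \<Rightarrow> _" assume A: "range A \<subseteq> sets R" "disjoint_family A"
    have "(\<Sum>i. emeasure R (A i) + emeasure T (A i)) = (\<Sum>i. emeasure R (A i)) + (\<Sum>i. emeasure T (A i))"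
      by (rule suminf_add[symmetric]) auto
    with A assms(1) show "(\<Sum>i. emeasure R (A i) + emeasure T (A i)) = emeasure R (\<Union> (range A)) + emeasure T (\<Union> (range A))"
      by (simp add: suminf_emeasure)
  qed
qed (use assms in simp)

lemma hellinger_density:
  fixes f g :: "'x \<Rightarrow> real"
  assumes "sigma_finite_measure L"
    and [measurable]: "f \<in> borel_measurable L" "g \<in> borel_measurable L"
    and nonneg: "\<And>x. x \<in> space L \<Longrightarrow> 0 \<le> f x" "\<And>x. x \<in> space L \<Longrightarrow> 0 \<le> g x"
    and "prob_space (density L f)" "prob_space (density L g)"
  shows "hellinger (density L f) (density L g) = sqrt (1 / 2 * (\<integral>x. (sqrt (f x) - sqrt (g x))\<^sup>2 \<partial>L))"
proof -
  interpret L: sigma_finite_measure L by fact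
  define R where "R = density L f"
  define T where "T = density L g"
  define M where "M = sum_measure R T"
  interpret R: prob_space R using assms by (simp add: R_def)
  interpret T: prob_space T using assms by (simp add: T_def)
  have [measurable_cong]: "sets M = sets L" "sets R = sets L" "sets T = sets L"
    by (simp_all add: M_def R_def T_def)
  have spM: "space M = space L" by (rule sets_eq_imp_space_eq) fact
  have eM: "emeasure M A = emeasure R A + emeasure T A" if "A \<in> sets L" for A
    unfolding M_def using that by (subst emeasure_sum_measure) (simp_all add: R_def T_def)
  have M_eq: "M = density L (\<lambda>x. ennreal (f x + g x))"
  proof (rule measure_eqI)
    fix A assume "A \<in> sets M"
    then have [measurable]: "A \<in> sets L" by (simp add: \<open>sets M = sets L\<close>)
    have "emeasure M A = (\<integral>\<^sup>+x. ennreal (f x) * indicator A x \<partial>L) + (\<integral>\<^sup>+x. ennreal (g x) * indicator A x \<partial>L)"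
      by (simp add: eM R_def T_def emeasure_density)
    also have "\<dots> = (\<integral>\<^sup>+x. ennreal (f x) * indicator A x + ennreal (g x) * indicator A x \<partial>L)"
      by (rule nn_integral_add[symmetric]) auto
    also have "\<dots> = (\<integral>\<^sup>+x. ennreal (f x + g x) * indicator A x \<partial>L)"
      by (rule nn_integral_cong) (simp add: nonneg ennreal_plus distrib_right)
    finally show "emeasure M A = emeasure (density L (\<lambda>x. ennreal (f x + g x))) A"
      by (simp add: emeasure_density)
  qed (simp add: \<open>sets M = sets L\<close>)
  have "finite_measure M"
    by (rule finite_measureI)
       (use R.emeasure_finite[of "space R"] T.emeasure_finite[of "space T"] in
         \<open>auto simp: spM eM R_def T_def\<close>)
  then interpret M: finite_measure M .
  have key: "AE x in L. f' x = (f x + g x) * enn2real (RN_deriv M (density L f') x)"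
    if [measurable]: "f' \<in> borel_measurable L" and nn: "\<And>x. x \<in> space L \<Longrightarrow> 0 \<le> f' x"
      and "finite_measure (density L f')" and dom: "\<And>A. A \<in> sets L \<Longrightarrow> emeasure (density L f') A \<le> emeasure M A"
    for f' :: "'x \<Rightarrow> real"
  proof -
    interpret F: finite_measure "density L f'" by fact
    have ac: "absolutely_continuous M (density L f')"
      unfolding absolutely_continuous_def
      using dom by (fastforce simp: null_sets_def \<open>sets M = sets L\<close>)
    have d: "density M (RN_deriv M (density L f')) = density L f'"
      by (rule M.density_RN_deriv[OF ac]) (simp add: \<open>sets M = sets L\<close>)
    have fin: "AE x in M. RN_deriv M (density L f') x \<noteq> \<infinity>"
      by (rule M.RN_deriv_finite[OF _ ac]) (unfold_locales, simp add: \<open>sets M = sets L\<close>)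
    have [measurable]: "RN_deriv M (density L f') \<in> borel_measurable L"
      by (rule measurable_compose[OF _ borel_measurable_RN_deriv, of id, simplified]) 
         (simp add: measurable_def \<open>sets M = sets L\<close> spM)
    have "density L (\<lambda>x. ennreal (f x + g x) * RN_deriv M (density L f') x) = density L (\<lambda>x. ennreal (f' x))"
      using d by (subst (asm) (1) M_eq) (subst (asm) density_density_eq, auto)
    then have "AE x in L. ennreal (f x + g x) * RN_deriv M (density L f') x = ennreal (f' x)"
      by (subst (asm) L.density_unique_iff) auto
    moreover have "AE x in L. 0 < ennreal (f x + g x) \<longrightarrow> RN_deriv M (density L f') x \<noteq> \<infinity>"
      using fin by (subst (asm) (1) M_eq) (simp add: AE_density)
    ultimately show ?thesis
      using AE_space
    proof eventually_elim
      case (elim x)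
      show ?case
      proof (cases "f x + g x = 0")
        case True
        with elim nn show ?thesis by (simp add: ennreal_eq_0_iff order_antisym)
      next
        case False
        with elim have pos: "f x + g x > 0"
          using nonneg[of x] by (auto simp: less_le)
        with elim have "RN_deriv M (density L f') x \<noteq> \<infinity>" by simp
        then obtain r where r: "RN_deriv M (density L f') x = ennreal r" "0 \<le> r"
          by (cases "RN_deriv M (density L f') x") auto
        with elim pos nn[of x] show ?thesis
          by (simp add: ennreal_mult[symmetric])
      qed
    qed
  qed
  define r where "r = (\<lambda>x. enn2real (RN_deriv M R x))"
  define q where "q = (\<lambda>x. enn2real (RN_deriv M T x))"
  have [measurable]: "r \<in> borel_measurable L" "q \<in> borel_measurable L"
  proof -
    have "r \<in> borel_measurable M" "q \<in> borel_measurable M" by (simp_all add: r_def q_def)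
    then show "r \<in> borel_measurable L" "q \<in> borel_measurable L"
      by (simp_all add: measurable_cong_sets[OF \<open>sets M = sets L\<close> refl])
  qed
  have fr: "AE x in L. f x = (f x + g x) * r x"
    unfolding r_def R_def using nonneg R.finite_measure_axioms
    by (intro key) (auto simp: R_def eM)
  have gq: "AE x in L. g x = (f x + g x) * q x"
    unfolding q_def T_def using nonneg T.finite_measure_axioms
    by (intro key) (auto simp: T_def eM)
  have "(\<integral>x. (sqrt (r x) - sqrt (q x))\<^sup>2 \<partial>M) = (\<integral>x. (f x + g x) * (sqrt (r x) - sqrt (q x))\<^sup>2 \<partial>L)"
    unfolding M_eq using nonneg by (subst integral_density) auto
  also have "\<dots> = (\<integral>x. (sqrt (f x) - sqrt (g x))\<^sup>2 \<partial>L)"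
  proof (rule integral_cong_AE)
    show "AE x in L. (f x + g x) * (sqrt (r x) - sqrt (q x))\<^sup>2 = (sqrt (f x) - sqrt (g x))\<^sup>2"
      using fr gq AE_space
    proof eventually_elim
      case (elim x)
      have "(sqrt (f x) - sqrt (g x))\<^sup>2 = (sqrt ((f x + g x) * r x) - sqrt ((f x + g x) * q x))\<^sup>2"
        using elim(1,2) by simp
      also have "\<dots> = (sqrt (f x + g x))\<^sup>2 * (sqrt (r x) - sqrt (q x))\<^sup>2"
        by (simp only: real_sqrt_mult power_mult_distrib[symmetric] right_diff_distrib)
      also have "\<dots> = (f x + g x) * (sqrt (r x) - sqrt (q x))\<^sup>2"
        using nonneg[OF elim(3)] by simp
      finally show ?case by simp
    qed
  qed auto
  finally show ?thesis
    by (simp add: hellinger_def Let_def r_def q_def M_def R_def T_def)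
qed

end

theory Submission
  imports Defs
begin

text \<open>Let \<open>B\<close> be the ball of radius \<open>2\<^sup>-\<^sup>J\<close> around \<open>s\<close>, and let \<open>Q\<close> be the mixture of the product laws
\<open>P\<^sub>t\<^sup>n\<close> for \<open>t\<close> drawn from the prior conditioned on \<open>B\<close>. The divergence of the law of the sample from
\<open>Q\<close> is at most \<open>n * K\<close>, so every integrable \<open>Y\<close> satisfies \<open>E Y \<le> n * K + E\<^sub>Q (exp Y) - 1\<close>
(lemma \<open>averaged_kullback_variational\<close>). Taking for \<open>Y\<close> a small multiple of
\<open>n * h\<^sup>2 (est, s) / \<Delta>\<^sup>2\<close> minus a multiple of \<open>n / 4\<^sup>J\<close>, it suffices to bound an exponential moment under
\<open>Q\<close>. The misspecification of the model has been paid for by the term \<open>K\<close>, and from here on the sample comes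
from the model, at a random parameter in \<open>B\<close>.

Working under \<open>Q\<close> also removes the random denominator of the posterior: the posterior mass of a set \<open>A\<close>,
multiplied by the density of \<open>Q\<close>, is at most \<open>1 / \<nu> B\<close> times the integral of the likelihood over \<open>A\<close>
(lemma \<open>posterior_mass\<close>). On the event that a test accepts \<open>B\<close>, its expectation is at most the error of
the test on \<open>A\<close> times \<open>\<nu> A / \<nu> B\<close>. This is applied to the dyadic shells \<open>A\<^sub>i\<close> of radius about
\<open>2\<^sup>-\<^sup>i\<close>. Products of ratios \<open>(u + 2v) / (2u + v)\<close> of square roots of densities give tests between small
Hellinger balls with explicit exponents (lemmas \<open>integral_root_ratio_le\<close> and \<open>test_error\<close>), the entropy
condition combines them into a test against a whole shell (lemma \<open>shell_test\<close>), and its exponent exceeds the one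
allowed for \<open>\<nu> A\<^sub>i / \<nu> B\<close> by the prior growth condition.

The last ingredient is deterministic: if the posterior puts little mass, suitably weighted, outside the ball of
radius \<open>2\<^sup>-\<^sup>j\<close>, then a point at distance more than \<open>\<Delta> * 2\<^sup>-\<^sup>j\<close> from \<open>s\<close> has larger posterior
risk than \<open>s\<close> and cannot be the Bayes estimator (lemma \<open>minimizer_near_concentration_point\<close>). Hence the loss is
controlled by the first shell whose test or posterior mass misbehaves, and summing the probabilities over the shells
bounds the exponential moment by an absolute constant (lemma \<open>exp_loss_integral\<close>).\<close>

section \<open>Square roots of densities and the Hellinger metric\<close>

definition prob_density :: "'x measure \<Rightarrow> ('x \<Rightarrow> real) \<Rightarrow> bool" where
  "prob_density M p \<longleftrightarrow>
     p \<in> borel_measurable M \<and> (\<forall>x\<in>space M. 0 \<le> p x) \<and> prob_space (density M (\<lambda>x. ennreal (p x)))"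

definition affinity :: "'x measure \<Rightarrow> ('x \<Rightarrow> real) \<Rightarrow> ('x \<Rightarrow> real) \<Rightarrow> real" where
  "affinity M p q = (\<integral>x. sqrt (p x) * sqrt (q x) \<partial>M)"

lemma square_integrable_product:
  fixes a b :: "'x \<Rightarrow> real"
  assumes [measurable]: "a \<in> borel_measurable M" "b \<in> borel_measurable M"
    and "integrable M (\<lambda>x. (a x)\<^sup>2)" "integrable M (\<lambda>x. (b x)\<^sup>2)"
  shows "integrable M (\<lambda>x. a x * b x)"
proof (rule Bochner_Integration.integrable_bound)
  show "integrable M (\<lambda>x. (a x)\<^sup>2 + (b x)\<^sup>2)" using assms by simp
  have "\<bar>u * v\<bar> \<le> \<bar>u\<^sup>2 + v\<^sup>2\<bar>" for u v :: real
  proof -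
    have "2 * \<bar>u * v\<bar> \<le> u\<^sup>2 + v\<^sup>2"
      using sum_squares_bound[of "\<bar>u\<bar>" "\<bar>v\<bar>"] by (simp add: abs_mult)
    then show ?thesis using abs_ge_zero[of "u * v"] abs_ge_self[of "u\<^sup>2 + v\<^sup>2"] by linarith
  qed
  then show "AE x in M. norm (a x * b x) \<le> norm ((a x)\<^sup>2 + (b x)\<^sup>2)" by simp
qed simp

lemma Cauchy_Schwarz_integral:
  fixes a b :: "'x \<Rightarrow> real"
  assumes [measurable]: "a \<in> borel_measurable M" "b \<in> borel_measurable M"
    and ia: "integrable M (\<lambda>x. (a x)\<^sup>2)" and ib: "integrable M (\<lambda>x. (b x)\<^sup>2)"
  shows "(\<integral>x. a x * b x \<partial>M)\<^sup>2 \<le> (\<integral>x. (a x)\<^sup>2 \<partial>M) * (\<integral>x. (b x)\<^sup>2 \<partial>M)"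
proof -
  have iab: "integrable M (\<lambda>x. a x * b x)" by (rule square_integrable_product) fact+
  have "ennreal ((\<integral>x. \<bar>a x * b x\<bar> \<partial>M)\<^sup>2) = (\<integral>\<^sup>+x. ennreal \<bar>a x\<bar> * ennreal \<bar>b x\<bar> \<partial>M)\<^sup>2"
    using iab by (simp add: nn_integral_eq_integral ennreal_power flip: ennreal_mult abs_mult)
  also have "\<dots> \<le> (\<integral>\<^sup>+x. (ennreal \<bar>a x\<bar>)\<^sup>2 \<partial>M) * (\<integral>\<^sup>+x. (ennreal \<bar>b x\<bar>)\<^sup>2 \<partial>M)"
    by (rule Cauchy_Schwarz_nn_integral) auto
  also have "\<dots> = ennreal ((\<integral>x. (a x)\<^sup>2 \<partial>M) * (\<integral>x. (b x)\<^sup>2 \<partial>M))"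
    using ia ib by (simp add: ennreal_power nn_integral_eq_integral ennreal_mult)
  finally have "(\<integral>x. \<bar>a x * b x\<bar> \<partial>M)\<^sup>2 \<le> (\<integral>x. (a x)\<^sup>2 \<partial>M) * (\<integral>x. (b x)\<^sup>2 \<partial>M)"
    by (subst (asm) ennreal_le_iff) auto
  moreover have "\<bar>\<integral>x. a x * b x \<partial>M\<bar> \<le> (\<integral>x. \<bar>a x * b x\<bar> \<partial>M)"
    using integral_norm_bound[of M "\<lambda>x. a x * b x"] by simp
  then have "(\<integral>x. a x * b x \<partial>M)\<^sup>2 \<le> (\<integral>x. \<bar>a x * b x\<bar> \<partial>M)\<^sup>2"
    by (metis abs_ge_zero power2_abs power_mono)
  ultimately show ?thesis by linarith
qed

lemma Minkowski_integral:
  fixes a b :: "'x \<Rightarrow> real"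
  assumes [measurable]: "a \<in> borel_measurable M" "b \<in> borel_measurable M"
    and ia: "integrable M (\<lambda>x. (a x)\<^sup>2)" and ib: "integrable M (\<lambda>x. (b x)\<^sup>2)"
  shows "sqrt (\<integral>x. (a x + b x)\<^sup>2 \<partial>M) \<le> sqrt (\<integral>x. (a x)\<^sup>2 \<partial>M) + sqrt (\<integral>x. (b x)\<^sup>2 \<partial>M)"
proof -
  define A B where "A = (\<integral>x. (a x)\<^sup>2 \<partial>M)" and "B = (\<integral>x. (b x)\<^sup>2 \<partial>M)"
  have AB: "0 \<le> A" "0 \<le> B" by (simp_all add: A_def B_def)
  have iab: "integrable M (\<lambda>x. a x * b x)" by (rule square_integrable_product) fact+
  have "(\<integral>x. a x * b x \<partial>M) \<le> sqrt (A * B)"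
    using Cauchy_Schwarz_integral[OF assms] unfolding A_def B_def by (rule real_le_rsqrt)
  moreover have "(\<integral>x. (a x + b x)\<^sup>2 \<partial>M) = A + B + 2 * (\<integral>x. a x * b x \<partial>M)"
    using ia ib iab by (simp add: A_def B_def power2_sum mult.assoc)
  ultimately have "(\<integral>x. (a x + b x)\<^sup>2 \<partial>M) \<le> (sqrt A + sqrt B)\<^sup>2"
    using AB by (simp add: power2_sum real_sqrt_mult)
  then show ?thesis using AB unfolding A_def[symmetric] B_def[symmetric]
    by (intro real_le_lsqrt) auto
qed

lemma prob_density_nn_integral:
  assumes p: "prob_density M p"
  shows "(\<integral>\<^sup>+x. ennreal (p x) \<partial>M) = 1"
proof -
  interpret prob_space "density M (\<lambda>x. ennreal (p x))" using p by (simp add: prob_density_def)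
  have [measurable]: "p \<in> borel_measurable M" using p by (simp add: prob_density_def)
  show ?thesis using emeasure_space_1 by (simp add: emeasure_density cong: nn_integral_cong)
qed

lemma
  assumes p: "prob_density M p"
  shows prob_density_integrable: "integrable M p"
    and prob_density_integral: "integral\<^sup>L M p = 1"
proof -
  have [measurable]: "p \<in> borel_measurable M" and nn: "AE x in M. 0 \<le> p x"
    using p by (auto simp: prob_density_def)
  show i: "integrable M p"
    using prob_density_nn_integral[OF p] nn by (intro integrableI_nonneg) auto
  show "integral\<^sup>L M p = 1"
    using prob_density_nn_integral[OF p] nn by (subst integral_eq_nn_integral) auto
qed

lemma sqrt_prob_density:
  assumes "prob_density M p"
  shows "(\<lambda>x. sqrt (p x)) \<in> borel_measurable M" "integrable M (\<lambda>x. (sqrt (p x))\<^sup>2)"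
    "(\<integral>x. (sqrt (p x))\<^sup>2 \<partial>M) = 1"
proof -
  have nn: "\<And>x. x \<in> space M \<Longrightarrow> 0 \<le> p x" using assms by (auto simp: prob_density_def)
  have "p \<in> borel_measurable M" using assms by (simp add: prob_density_def)
  then show "(\<lambda>x. sqrt (p x)) \<in> borel_measurable M" by simp
  show "integrable M (\<lambda>x. (sqrt (p x))\<^sup>2)"
    using prob_density_integrable[OF assms]
    by (subst Bochner_Integration.integrable_cong[OF refl, of _ _ p]) (auto simp: nn)
  show "(\<integral>x. (sqrt (p x))\<^sup>2 \<partial>M) = 1"
    using prob_density_integral[OF assms]
    by (subst Bochner_Integration.integral_cong[OF refl, of _ _ p]) (auto simp: nn)
qed

lemma integrable_sqrt_prod:
  assumes "prob_density M p" "prob_density M q"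
  shows "integrable M (\<lambda>x. sqrt (p x) * sqrt (q x))"
  by (intro square_integrable_product sqrt_prob_density assms)

text \<open>The usual formula for the distance between two laws with densities holds for every dominating
measure, \<open>\<sigma>\<close>-finite or not: only the finite measure with density \<open>p + q\<close> matters, and
\<open>p / (p + q)\<close> and \<open>q / (p + q)\<close> are densities with respect to it.\<close>
lemma hellinger_prob_density:
  assumes p: "prob_density M p" and q: "prob_density M q"
  shows "hellinger (density M p) (density M q) = sqrt (1 / 2 * (\<integral>x. (sqrt (p x) - sqrt (q x))\<^sup>2 \<partial>M))"
proof -
  have [measurable]: "p \<in> borel_measurable M" "q \<in> borel_measurable M"
    and nn: "\<And>x. x \<in> space M \<Longrightarrow> 0 \<le> p x" "\<And>x. x \<in> space M \<Longrightarrow> 0 \<le> q x"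
    using p q by (auto simp: prob_density_def)
  define L where "L = density M (\<lambda>x. ennreal (p x + q x))"
  have "emeasure L (space L) = (\<integral>\<^sup>+x. ennreal (p x) + ennreal (q x) \<partial>M)"
    by (auto simp: L_def emeasure_density nn intro!: nn_integral_cong)
  also have "\<dots> = 1 + 1"
    by (simp only: measurable_compose[OF _ measurable_ennreal] \<open>p \<in> borel_measurable M\<close> \<open>q \<in> borel_measurable M\<close> nn_integral_add prob_density_nn_integral[OF p] prob_density_nn_integral[OF q])
  finally interpret L: finite_measure L by (intro finite_measureI) auto
  have dens: "density L (\<lambda>x. ennreal (h x / (p x + q x))) = density M (\<lambda>x. ennreal (h x))"
    if [measurable]: "h \<in> borel_measurable M"
      and h: "\<And>x. x \<in> space M \<Longrightarrow> 0 \<le> h x" "\<And>x. x \<in> space M \<Longrightarrow> h x \<le> p x + q x" for h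
  proof -
    have "ennreal (p x + q x) * ennreal (h x / (p x + q x)) = ennreal (h x)" if "x \<in> space M" for x
    proof (cases "p x + q x = 0")
      case True
      with h[OF that] show ?thesis by simp
    next
      case False
      then show ?thesis using h[OF that] nn[OF that]
        by (simp add: ennreal_mult[symmetric] del: ennreal_plus)
    qed
    then show ?thesis unfolding L_def
      by (subst density_density_eq) (auto intro!: density_cong)
  qed
  have dp: "density L (\<lambda>x. ennreal (p x / (p x + q x))) = density M p"
    and dq: "density L (\<lambda>x. ennreal (q x / (p x + q x))) = density M q"
    using nn by (intro dens; force)+
  have "hellinger (density M p) (density M q) =
    sqrt (1 / 2 * (\<integral>x. (sqrt (p x / (p x + q x)) - sqrt (q x / (p x + q x)))\<^sup>2 \<partial>L))"
    unfolding dp[symmetric] dq[symmetric]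
  proof (rule hellinger_density)
    show "sigma_finite_measure L" by unfold_locales
    show "prob_space (density L (\<lambda>x. ennreal (p x / (p x + q x))))"
      "prob_space (density L (\<lambda>x. ennreal (q x / (p x + q x))))"
      using p q unfolding dp dq by (auto simp: prob_density_def)
  qed (use nn in \<open>auto simp: L_def\<close>)
  also have "(\<integral>x. (sqrt (p x / (p x + q x)) - sqrt (q x / (p x + q x)))\<^sup>2 \<partial>L) =
    (\<integral>x. (p x + q x) * (sqrt (p x / (p x + q x)) - sqrt (q x / (p x + q x)))\<^sup>2 \<partial>M)"
    unfolding L_def using nn by (subst integral_density) auto
  also have "\<dots> = (\<integral>x. (sqrt (p x) - sqrt (q x))\<^sup>2 \<partial>M)"
  proof (rule Bochner_Integration.integral_cong[OF refl])
    fix x assume "x \<in> space M"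
    note nn[OF this]
    then show "(p x + q x) * (sqrt (p x / (p x + q x)) - sqrt (q x / (p x + q x)))\<^sup>2
      = (sqrt (p x) - sqrt (q x))\<^sup>2"
      by (cases "p x + q x = 0")
         (auto simp: real_sqrt_divide diff_divide_distrib[symmetric] power_divide)
  qed
  finally show ?thesis .
qed

lemma hellinger_square:
  assumes p: "prob_density M p" and q: "prob_density M q"
  shows "(hellinger (density M p) (density M q))\<^sup>2 = 1 - affinity M p q"
proof -
  note P = sqrt_prob_density[OF p] and Q = sqrt_prob_density[OF q]
  have "(\<integral>x. (sqrt (p x) - sqrt (q x))\<^sup>2 \<partial>M) = 2 - 2 * affinity M p q"
    using P Q integrable_sqrt_prod[OF p q] by (simp add: power2_diff affinity_def mult.assoc)
  moreover have "0 \<le> (\<integral>x. (sqrt (p x) - sqrt (q x))\<^sup>2 \<partial>M)" by simp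
  ultimately show ?thesis unfolding hellinger_prob_density[OF p q] by simp
qed

lemma affinity_nonneg: "prob_density M p \<Longrightarrow> prob_density M q \<Longrightarrow> 0 \<le> affinity M p q"
  unfolding affinity_def by (rule integral_nonneg_AE) (auto simp: prob_density_def)

text \<open>The Hellinger distance is, up to the factor \<open>1 / sqrt 2\<close>, the \<open>L\<^sup>2\<close> distance of the square roots
of the densities.\<close>
lemma hellinger_triangle:
  assumes p: "prob_density M p" and q: "prob_density M q" and r: "prob_density M r"
  shows "hellinger (density M p) (density M r)
    \<le> hellinger (density M p) (density M q) + hellinger (density M q) (density M r)"
proof -
  have sq: "integrable M (\<lambda>x. (sqrt (a x) - sqrt (b x))\<^sup>2)"
    if "prob_density M a" "prob_density M b" for a b
    using sqrt_prob_density[OF that(1)] sqrt_prob_density[OF that(2)] integrable_sqrt_prod[OF that]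
    by (simp add: power2_diff mult.assoc)
  have "sqrt (\<integral>x. ((sqrt (p x) - sqrt (q x)) + (sqrt (q x) - sqrt (r x)))\<^sup>2 \<partial>M)
    \<le> sqrt (\<integral>x. (sqrt (p x) - sqrt (q x))\<^sup>2 \<partial>M) + sqrt (\<integral>x. (sqrt (q x) - sqrt (r x))\<^sup>2 \<partial>M)"
    using sqrt_prob_density(1)[OF p] sqrt_prob_density(1)[OF q] sqrt_prob_density(1)[OF r]
    by (intro Minkowski_integral sq p q r borel_measurable_diff)
  then show ?thesis
    unfolding hellinger_prob_density[OF p q] hellinger_prob_density[OF q r]
      hellinger_prob_density[OF p r]
    by (simp add: real_sqrt_mult[of "1/2"] real_sqrt_divide divide_simps mult.commute)
qed

lemma hellinger_eq_0_imp:
  assumes p: "prob_density M p" and q: "prob_density M q"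
    and 0: "hellinger (density M p) (density M q) = 0"
  shows "density M p = density M q"
proof -
  have [measurable]: "p \<in> borel_measurable M" "q \<in> borel_measurable M"
    and nn: "\<And>x. x \<in> space M \<Longrightarrow> 0 \<le> p x" "\<And>x. x \<in> space M \<Longrightarrow> 0 \<le> q x"
    using p q by (auto simp: prob_density_def)
  have i: "integrable M (\<lambda>x. (sqrt (p x) - sqrt (q x))\<^sup>2)"
    using sqrt_prob_density[OF p] sqrt_prob_density[OF q] integrable_sqrt_prod[OF p q]
    by (simp add: power2_diff mult.assoc)
  have "(\<integral>x. (sqrt (p x) - sqrt (q x))\<^sup>2 \<partial>M) = 0"
    using 0 unfolding hellinger_prob_density[OF p q] by simp
  then have "AE x in M. (sqrt (p x) - sqrt (q x))\<^sup>2 = 0"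
    using i by (subst (asm) integral_nonneg_eq_0_iff_AE) auto
  then have "AE x in M. p x = q x" by eventually_elim simp
  then show ?thesis by (intro density_cong) auto
qed

context bayes_model
begin

abbreviation h :: "'s \<Rightarrow> 's \<Rightarrow> real" where "h \<equiv> hdist \<mu> f"

lemma space_hborel: "space (hborel \<mu> f S) = S"
  unfolding hborel_def by (simp add: space_measure_of_conv)

lemma prob_density_model: "t \<in> S \<Longrightarrow> prob_density \<mu> (f t)"
  using density_nonneg prob_model[of t] measurable_Pair2[OF joint_measurable, of t]
  by (simp add: prob_density_def model_dist_def space_hborel)

lemma h_square: "t \<in> S \<Longrightarrow> u \<in> S \<Longrightarrow> (h t u)\<^sup>2 = 1 - affinity \<mu> (f t) (f u)"
  by (simp add: hdist_def model_dist_def hellinger_square prob_density_model)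

lemma h_nonneg: "t \<in> S \<Longrightarrow> u \<in> S \<Longrightarrow> 0 \<le> h t u"
  by (simp add: hdist_def model_dist_def hellinger_prob_density prob_density_model)

lemma h_le_1:
  assumes "t \<in> S" "u \<in> S"
  shows "h t u \<le> 1"
proof -
  have "(h t u)\<^sup>2 \<le> 1" using assms by (simp add: h_square affinity_nonneg prob_density_model)
  then show ?thesis by (simp add: abs_square_le_1)
qed

lemma metric_h: "Metric_space S h"
proof
  show "0 \<le> h t u" for t u
    by (simp add: hdist_def hellinger_def Let_def)
  show "h t u = h u t" for t u
    by (simp add: hdist_def hellinger_def Let_def sum_measure_def model_dist_def power2_commute
      add.commute)
  show "h t u = 0 \<longleftrightarrow> t = u" if "t \<in> S" "u \<in> S" for t u
  proof
    show "t = u" if "h t u = 0"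
      using inj_onD[OF inj_model, of t u] that \<open>t \<in> S\<close> \<open>u \<in> S\<close>
      by (auto simp: hdist_def model_dist_def intro!: hellinger_eq_0_imp prob_density_model)
    show "h t u = 0" if "t = u"
      using prob_density_model[OF \<open>u \<in> S\<close>] that
      by (simp add: hdist_def model_dist_def hellinger_prob_density)
  qed
  show "h t v \<le> h t u + h u v" if "t \<in> S" "u \<in> S" "v \<in> S" for t u v
    using that by (simp add: hdist_def model_dist_def hellinger_triangle prob_density_model)
qed

end

section \<open>A likelihood ratio that is robust to small Hellinger perturbations\<close>

text \<open>With \<open>u = sqrt p\<close> and \<open>v = sqrt q\<close>, this is the ratio \<open>(u + 2v) / (2u + v)\<close> of two interior points
of the arc joining the unit vectors \<open>u\<close> and \<open>v\<close> of \<open>L\<^sup>2\<close>. Unlike \<open>v / u\<close> it lies between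
\<open>1/2\<close> and \<open>2\<close>. The value 1 where both densities vanish keeps it equal to the inverse of the ratio
with \<open>p\<close> and \<open>q\<close> exchanged.\<close>
definition root_ratio :: "('x \<Rightarrow> real) \<Rightarrow> ('x \<Rightarrow> real) \<Rightarrow> 'x \<Rightarrow> real" where
  "root_ratio p q x = (if p x = 0 \<and> q x = 0 then 1
     else (sqrt (p x) + 2 * sqrt (q x)) / (2 * sqrt (p x) + sqrt (q x)))"

lemma root_ratio_swap: "root_ratio q p x = 1 / root_ratio p q x"
  by (simp add: root_ratio_def add.commute)

lemma root_ratio_nonneg: "0 \<le> p x \<Longrightarrow> 0 \<le> q x \<Longrightarrow> 0 \<le> root_ratio p q x"
  by (simp add: root_ratio_def)

lemma root_ratio_pos: "0 \<le> p x \<Longrightarrow> 0 \<le> q x \<Longrightarrow> 0 < root_ratio p q x"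
  by (auto simp: root_ratio_def less_le add_nonneg_eq_0_iff intro!: divide_nonneg_nonneg)

lemma root_ratio_le:
  assumes "0 \<le> p x" "0 \<le> q x"
  shows "root_ratio p q x \<le> 2 - 3 * (sqrt (p x) / (2 * sqrt (p x) + sqrt (q x)))"
proof (cases "p x = 0 \<and> q x = 0")
  case True
  then show ?thesis by (simp add: root_ratio_def)
next
  case False
  then have "0 < 2 * sqrt (p x) + sqrt (q x)"
    using assms by (auto simp: less_le add_nonneg_eq_0_iff)
  with False show ?thesis by (auto simp: root_ratio_def divide_simps)
qed

lemma borel_measurable_root_ratio [measurable (raw)]:
  assumes [measurable]: "p \<in> borel_measurable M" "q \<in> borel_measurable M"
  shows "root_ratio p q \<in> borel_measurable M"
  unfolding root_ratio_def by measurable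

text \<open>Put \<open>k = u / (2u + v)\<close>, so that the ratio is \<open>2 - 3k\<close>. Since \<open>sqrt (r k) * sqrt (u (2u + v)) = sqrt r * u\<close>,
the Cauchy-Schwarz inequality bounds the integral of \<open>r k\<close> from below by
\<open>(affinity r p)\<^sup>2 / (2 + affinity p q)\<close>. This holds for every density \<open>r\<close>, which is the source of the
robustness: \<open>r\<close> enters only through its affinity to \<open>p\<close>.\<close>
lemma integral_root_ratio_le:
  assumes p: "prob_density M p" and q: "prob_density M q" and r: "prob_density M r"
  shows "(\<integral>\<^sup>+x. ennreal (root_ratio p q x) * ennreal (r x) \<partial>M)
    \<le> ennreal (2 - 3 * (affinity M r p)\<^sup>2 / (2 + affinity M p q))"
proof -
  have [measurable]: "p \<in> borel_measurable M" "q \<in> borel_measurable M" "r \<in> borel_measurable M"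
    and nn: "\<And>x. x \<in> space M \<Longrightarrow> 0 \<le> p x" "\<And>x. x \<in> space M \<Longrightarrow> 0 \<le> q x"
      "\<And>x. x \<in> space M \<Longrightarrow> 0 \<le> r x"
    using p q r by (auto simp: prob_density_def)
  define k where "k x = sqrt (p x) / (2 * sqrt (p x) + sqrt (q x))" for x
  have k: "0 \<le> k x" "k x \<le> 1" if "x \<in> space M" for x
    using nn[OF that] unfolding k_def
    by (auto intro!: divide_nonneg_nonneg divide_le_eq_1[THEN iffD2] simp: not_less)
       (smt (verit) real_sqrt_ge_zero)
  have [measurable]: "k \<in> borel_measurable M" unfolding k_def by measurable
  have irk: "integrable M (\<lambda>x. r x * k x)"
  proof (rule Bochner_Integration.integrable_bound[OF prob_density_integrable[OF r]])
    show "AE x in M. norm (r x * k x) \<le> norm (r x)"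
      using k nn by (auto intro!: AE_I2 mult_right_le_one_le simp: abs_mult)
  qed simp
  define b where "b x = sqrt (sqrt (p x) * (2 * sqrt (p x) + sqrt (q x)))" for x
  have b2: "(b x)\<^sup>2 = 2 * (sqrt (p x))\<^sup>2 + sqrt (p x) * sqrt (q x)" if "x \<in> space M" for x
    using nn[OF that] unfolding b_def
    by (subst real_sqrt_pow2) (auto simp: power2_eq_square algebra_simps)
  have a2: "(sqrt (r x * k x))\<^sup>2 = r x * k x" if "x \<in> space M" for x
    using nn[OF that] k[OF that] by simp
  have ib: "integrable M (\<lambda>x. (b x)\<^sup>2)"
    and ib_eq: "(\<integral>x. (b x)\<^sup>2 \<partial>M) = 2 + affinity M p q"
    using sqrt_prob_density[OF p] integrable_sqrt_prod[OF p q]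
    by (simp_all add: b2 affinity_def cong: Bochner_Integration.integrable_cong
        Bochner_Integration.integral_cong)
  have ia: "integrable M (\<lambda>x. (sqrt (r x * k x))\<^sup>2)"
    using irk by (simp add: a2 cong: Bochner_Integration.integrable_cong)
  have ab: "sqrt (r x * k x) * b x = sqrt (r x) * sqrt (p x)" if "x \<in> space M" for x
  proof (cases "p x = 0")
    case False
    define w where "w = 2 * sqrt (p x) + sqrt (q x)"
    have "0 < w" using nn[OF that] False by (auto simp: w_def intro!: add_pos_nonneg)
    then have "k x * (sqrt (p x) * w) = (sqrt (p x))\<^sup>2"
      by (simp add: k_def power2_eq_square flip: w_def)
    then have "sqrt (k x) * b x = sqrt (p x)"
      using nn[OF that] by (simp add: b_def real_sqrt_mult[symmetric] flip: w_def)
    then show ?thesis by (simp add: real_sqrt_mult mult.assoc)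
  qed (simp add: b_def k_def)
  have "(affinity M r p)\<^sup>2 = (\<integral>x. sqrt (r x * k x) * b x \<partial>M)\<^sup>2"
    unfolding affinity_def by (simp add: ab cong: Bochner_Integration.integral_cong)
  also have "\<dots> \<le> (\<integral>x. (sqrt (r x * k x))\<^sup>2 \<partial>M) * (\<integral>x. (b x)\<^sup>2 \<partial>M)"
    by (intro Cauchy_Schwarz_integral ia ib) (simp_all add: b_def)
  also have "\<dots> = (\<integral>x. r x * k x \<partial>M) * (2 + affinity M p q)"
    by (simp add: ib_eq a2 cong: Bochner_Integration.integral_cong)
  finally have CS: "(affinity M r p)\<^sup>2 / (2 + affinity M p q) \<le> (\<integral>x. r x * k x \<partial>M)"
    using affinity_nonneg[OF p q] by (simp add: divide_simps)
  have "(\<integral>\<^sup>+x. ennreal (root_ratio p q x) * ennreal (r x) \<partial>M)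
      \<le> (\<integral>\<^sup>+x. ennreal (2 * r x - 3 * (r x * k x)) \<partial>M)"
  proof (rule nn_integral_mono)
    fix x assume x: "x \<in> space M"
    have "root_ratio p q x * r x \<le> (2 - 3 * k x) * r x"
      using root_ratio_le[of p x q, OF nn(1)[OF x] nn(2)[OF x]] nn(3)[OF x] unfolding k_def
      by (rule mult_right_mono)
    then show "ennreal (root_ratio p q x) * ennreal (r x) \<le> ennreal (2 * r x - 3 * (r x * k x))"
      using root_ratio_nonneg[of p x q, OF nn(1)[OF x] nn(2)[OF x]] nn(3)[OF x]
      by (simp add: ennreal_mult[symmetric] ennreal_leI algebra_simps)
  qed
  also have "\<dots> = ennreal (\<integral>x. 2 * r x - 3 * (r x * k x) \<partial>M)"
  proof (rule nn_integral_eq_integral)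
    have "k x \<le> 2 / 3" if "x \<in> space M" for x
      using root_ratio_nonneg[of p x q] root_ratio_le[of p x q] nn(1)[OF that] nn(2)[OF that]
      by (simp add: k_def)
    then have "3 * (r x * k x) \<le> 2 * r x" if "x \<in> space M" for x
      using mult_left_mono[OF _ nn(3)[OF that], of "k x" "2/3"] that by force
    then show "AE x in M. 0 \<le> 2 * r x - 3 * (r x * k x)" by (intro AE_I2) auto
  qed (use irk prob_density_integrable[OF r] in simp)
  also have "(\<integral>x. 2 * r x - 3 * (r x * k x) \<partial>M) = 2 - 3 * (\<integral>x. r x * k x \<partial>M)"
    using irk prob_density_integrable[OF r] prob_density_integral[OF r] by simp
  also have "ennreal \<dots> \<le> ennreal (2 - 3 * (affinity M r p)\<^sup>2 / (2 + affinity M p q))"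
    using CS by (intro ennreal_leI) simp
  finally show ?thesis .
qed

text \<open>Here \<open>H\<close> and \<open>e\<close> are squared Hellinger distances, between the two centres and between the true density
and the first centre.\<close>
lemma robust_exponent:
  fixes e H :: real
  assumes "0 \<le> e" "0 \<le> H" "H \<le> 1"
  shows "2 - 3 * (1 - e)\<^sup>2 / (2 + (1 - H)) \<le> exp (- ((H - 8 * e) / 3))"
proof -
  define Y where "Y = (1 - e)\<^sup>2 / (3 - H)"
  \<comment> \<open>After division by \<open>3 - H\<close> the claim is that the following difference is nonnegative.\<close>
  have "0 \<le> (H - 3 * e)\<^sup>2 + 2 * e * (1 - H) + 4 * e" using assms by simp
  also have "\<dots> = 9 * (1 - e)\<^sup>2 - (3 - H) * (3 + H - 8 * e)"
    by (simp add: power2_eq_square algebra_simps)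
  finally have "3 + H - 8 * e \<le> 9 * Y"
    using assms by (simp add: Y_def pos_le_divide_eq mult.commute)
  then have "2 - 3 * Y \<le> 1 + - ((H - 8 * e) / 3)"
    by (simp add: field_simps)
  also have "\<dots> \<le> exp (- ((H - 8 * e) / 3))" by (rule exp_ge_add_one_self)
  finally show ?thesis by (simp add: Y_def)
qed

lemma robust_test_function:
  assumes p: "prob_density M p" and q: "prob_density M q" and r: "prob_density M r"
  shows "(\<integral>\<^sup>+x. ennreal (root_ratio p q x) * ennreal (r x) \<partial>M)
    \<le> ennreal (exp (- (((1 - affinity M p q) - 8 * (1 - affinity M r p)) / 3)))"
proof -
  have *: "affinity M a b \<le> 1" if "prob_density M a" "prob_density M b" for a b
    using hellinger_square[OF that] zero_le_power2[of "hellinger (density M a) (density M b)"]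
    by linarith
  show ?thesis
    using integral_root_ratio_le[OF assms]
      robust_exponent[of "1 - affinity M r p" "1 - affinity M p q"]
      *[OF p q] *[OF r p] affinity_nonneg[OF p q]
    by (auto intro: order_trans ennreal_leI)
qed

section \<open>Likelihoods relative to the true distribution\<close>

text \<open>All likelihoods are taken with respect to \<open>P\<close> itself, through a density \<open>p\<close> of \<open>P\<close>. The base
measure \<open>\<mu>\<close> may fail to be \<open>\<sigma>\<close>-finite, so product measures and Fubini's theorem are used for \<open>P\<close>
and the prior only.\<close>
locale sampled_model = bayes_model \<mu> S f \<nu> for \<mu> :: "'x measure" and S :: "'s set" and f \<nu> +
  fixes P :: "'x measure" and p :: "'x \<Rightarrow> real" and n :: nat
  assumes p_measurable: "p \<in> borel_measurable \<mu>"
    and p_nonneg: "\<And>x. x \<in> space \<mu> \<Longrightarrow> 0 \<le> p x"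
    and P_eq: "P = density \<mu> (\<lambda>x. ennreal (p x))"
    and prob_P: "prob_space P"
begin

text \<open>The density of the part of \<open>P\<^sub>t\<close> that is absolutely continuous with respect to \<open>P\<close>. Where \<open>p\<close> vanishes
it is 0, so it may integrate to less than 1; every estimate below only needs an upper bound.\<close>
definition g :: "'s \<Rightarrow> 'x \<Rightarrow> real" where "g t x = f t x / p x"

abbreviation PP :: "(nat \<Rightarrow> 'x) measure" where "PP \<equiv> Pi\<^sub>M {..<n} (\<lambda>_. P)"

abbreviation L :: "'s \<Rightarrow> (nat \<Rightarrow> 'x) \<Rightarrow> ennreal" where "L \<equiv> likelihood g n"

lemma sets_P [measurable_cong]: "sets P = sets \<mu>" by (simp add: P_eq)
lemma space_P: "space P = space \<mu>" by (simp add: P_eq)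
lemma space_prior: "space \<nu> = S" using sets_eq_imp_space_eq[OF sets_prior] space_hborel by simp

lemma g_measurable [measurable]: "(\<lambda>(t, x). g t x) \<in> borel_measurable (\<nu> \<Otimes>\<^sub>M P)"
proof -
  have "sets (\<nu> \<Otimes>\<^sub>M P) = sets (hborel \<mu> f S \<Otimes>\<^sub>M \<mu>)"
    by (intro sets_pair_measure_cong sets_prior sets_P)
  from measurable_cong_sets[OF this refl]
  have [measurable]: "(\<lambda>z. f (fst z) (snd z)) \<in> borel_measurable (\<nu> \<Otimes>\<^sub>M P)"
    using joint_measurable unfolding split_beta' by blast
  have [measurable]: "p \<in> borel_measurable P"
    using p_measurable measurable_cong_sets[OF sets_P refl] by blast
  show ?thesis unfolding g_def split_beta' by measurable
qed

lemma L_measurable [measurable]: "(\<lambda>(t, x). L t x) \<in> borel_measurable (\<nu> \<Otimes>\<^sub>M PP)"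
  unfolding likelihood_def split_beta'
proof (intro borel_measurable_prod_ennreal measurable_compose[OF _ measurable_ennreal])
  fix i assume i: "i \<in> {..<n}"
  have "(\<lambda>z. (fst z, snd z i)) \<in> \<nu> \<Otimes>\<^sub>M PP \<rightarrow>\<^sub>M \<nu> \<Otimes>\<^sub>M P" using i by measurable
  from measurable_compose[OF this g_measurable]
  show "(\<lambda>z. g (fst z) (snd z i)) \<in> borel_measurable (\<nu> \<Otimes>\<^sub>M PP)" by simp
qed

lemma L_measurable1 [measurable]: "t \<in> S \<Longrightarrow> L t \<in> borel_measurable PP"
  using measurable_Pair2[OF L_measurable, of t] by (simp add: space_prior)

lemma f_measurable: "t \<in> S \<Longrightarrow> f t \<in> borel_measurable \<mu>"
  using prob_density_model by (simp add: prob_density_def)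

lemma nn_integral_g_le:
  assumes t: "t \<in> S" and [measurable]: "\<phi> \<in> borel_measurable \<mu>"
  shows "(\<integral>\<^sup>+x. \<phi> x * ennreal (g t x) \<partial>P) \<le> (\<integral>\<^sup>+x. \<phi> x * ennreal (f t x) \<partial>\<mu>)"
proof -
  note [measurable] = f_measurable[OF t] p_measurable
  have "(\<integral>\<^sup>+x. \<phi> x * ennreal (g t x) \<partial>P) = (\<integral>\<^sup>+x. ennreal (p x) * (\<phi> x * ennreal (g t x)) \<partial>\<mu>)"
    unfolding P_eq g_def by (subst nn_integral_density) auto
  also have "\<dots> \<le> (\<integral>\<^sup>+x. \<phi> x * ennreal (f t x) \<partial>\<mu>)"
  proof (rule nn_integral_mono)
    fix x assume x: "x \<in> space \<mu>"
    have "ennreal (p x) * ennreal (g t x) \<le> ennreal (f t x)"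
      using p_nonneg[OF x] density_nonneg[OF t x]
      by (simp add: g_def ennreal_mult[symmetric])
    then have "\<phi> x * (ennreal (p x) * ennreal (g t x)) \<le> \<phi> x * ennreal (f t x)"
      by (rule mult_left_mono) simp
    then show "ennreal (p x) * (\<phi> x * ennreal (g t x)) \<le> \<phi> x * ennreal (f t x)"
      by (simp add: ac_simps)
  qed
  finally show ?thesis .
qed

lemma nn_integral_prod_L_le:
  assumes t: "t \<in> S" and [measurable]: "\<phi> \<in> borel_measurable \<mu>"
  shows "(\<integral>\<^sup>+x. (\<Prod>i<n. \<phi> (x i)) * L t x \<partial>PP) \<le> (\<integral>\<^sup>+x. \<phi> x * ennreal (f t x) \<partial>\<mu>) ^ n"
proof -
  interpret P: prob_space P by (rule prob_P)
  interpret product_sigma_finite "\<lambda>_::nat. P" by unfold_locales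
  note [measurable] = f_measurable[OF t] p_measurable
  have [measurable]: "g t \<in> borel_measurable P" unfolding g_def by measurable
  have "(\<integral>\<^sup>+x. (\<Prod>i<n. \<phi> (x i)) * L t x \<partial>PP) = (\<integral>\<^sup>+x. (\<Prod>i<n. \<phi> (x i) * ennreal (g t (x i))) \<partial>PP)"
    by (simp add: likelihood_def prod.distrib)
  also have "\<dots> = (\<Prod>i<n. \<integral>\<^sup>+x. \<phi> x * ennreal (g t x) \<partial>P)"
    by (rule product_nn_integral_prod) auto
  also have "\<dots> \<le> (\<integral>\<^sup>+x. \<phi> x * ennreal (f t x) \<partial>\<mu>) ^ n"
    using nn_integral_g_le[OF t, of \<phi>] by (simp add: power_mono)
  finally show ?thesis .
qed

lemma L_mass_le_1: "t \<in> S \<Longrightarrow> (\<integral>\<^sup>+x. L t x \<partial>PP) \<le> 1"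
  using nn_integral_prod_L_le[of t "\<lambda>_. 1"] prob_density_nn_integral[OF prob_density_model, of t]
  by simp

text \<open>The bound for one observation is raised to the power \<open>n\<close>, since the likelihood and the statistic are
both products over the coordinates.\<close>
lemma prod_root_ratio_L_le:
  assumes "s \<in> S" "v \<in> S" "t \<in> S"
  shows "(\<integral>\<^sup>+x. (\<Prod>i<n. ennreal (root_ratio (f s) (f v) (x i))) * L t x \<partial>PP)
    \<le> ennreal (exp (- (n * ((h s v)\<^sup>2 - 8 * (h t s)\<^sup>2) / 3)))"
proof -
  note [measurable] = f_measurable[OF assms(1)] f_measurable[OF assms(2)]
  have "(\<integral>\<^sup>+x. (\<Prod>i<n. ennreal (root_ratio (f s) (f v) (x i))) * L t x \<partial>PP)
    \<le> (\<integral>\<^sup>+x. ennreal (root_ratio (f s) (f v) x) * ennreal (f t x) \<partial>\<mu>) ^ n"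
    by (rule nn_integral_prod_L_le[OF assms(3)]) measurable
  also have "\<dots> \<le> ennreal (exp (- (((h s v)\<^sup>2 - 8 * (h t s)\<^sup>2) / 3))) ^ n"
    using robust_test_function[OF prob_density_model[OF assms(1)] prob_density_model[OF assms(2)]
      prob_density_model[OF assms(3)]] assms
    by (intro power_mono) (simp_all add: h_square)
  also have "\<dots> = ennreal (exp (- (n * ((h s v)\<^sup>2 - 8 * (h t s)\<^sup>2) / 3)))"
    by (simp add: ennreal_power exp_of_nat_mult[symmetric])
  finally show ?thesis .
qed

definition rejects :: "'s \<Rightarrow> 's \<Rightarrow> (nat \<Rightarrow> 'x) set" where
  "rejects s v = {x \<in> space PP. 1 \<le> (\<Prod>i<n. root_ratio (f s) (f v) (x i))}"

lemma rejects_sets: 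
  assumes "s \<in> S" "v \<in> S" shows "rejects s v \<in> sets PP"
proof -
  have "root_ratio (f s) (f v) \<in> borel_measurable P"
    using assms by (simp add: measurable_cong_sets[OF sets_P refl] borel_measurable_root_ratio
        f_measurable)
  then have [measurable]: "(\<lambda>x. root_ratio (f s) (f v) (x i)) \<in> borel_measurable PP" if "i \<in> {..<n}" for i
    using that by (intro measurable_compose[OF measurable_component_singleton])
  show ?thesis unfolding rejects_def by measurable
qed

text \<open>Markov's inequality: on the rejection region the product of the ratios is at least 1, and off it the product
of the inverse ratios is. The test of \<open>s\<close> against \<open>v\<close> therefore works at all parameters \<open>t\<close> close to
\<open>s\<close>, respectively close to \<open>v\<close>.\<close>
lemma test_error:
  assumes "s \<in> S" "v \<in> S" "t \<in> S"
  shows "(\<integral>\<^sup>+x. indicator (rejects s v) x * L t x \<partial>PP)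
      \<le> ennreal (exp (- (n * ((h s v)\<^sup>2 - 8 * (h t s)\<^sup>2) / 3)))" (is ?A)
    and "(\<integral>\<^sup>+x. indicator (space PP - rejects s v) x * L t x \<partial>PP)
      \<le> ennreal (exp (- (n * ((h s v)\<^sup>2 - 8 * (h t v)\<^sup>2) / 3)))" (is ?B)
proof -
  let ?r = "\<lambda>a b x. \<Prod>i<n. root_ratio (f a) (f b) (x i)"
  have pos: "0 < root_ratio (f a) (f b) (x i)"
    if "x \<in> space PP" "i < n" "a \<in> S" "b \<in> S" for a b x i
  proof (rule root_ratio_pos)
    have "x i \<in> space \<mu>" using that by (auto simp: space_PiM space_P)
    then show "0 \<le> f a (x i)" "0 \<le> f b (x i)" using that density_nonneg by auto
  qed
  have eq: "(\<Prod>i<n. ennreal (root_ratio (f a) (f b) (x i))) = ennreal (?r a b x)"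
    if "x \<in> space PP" "a \<in> S" "b \<in> S" for a b x
    using pos[OF that(1) _ that(2,3)] by (intro prod_ennreal) (auto intro: less_imp_le)
  have "(\<integral>\<^sup>+x. indicator (rejects s v) x * L t x \<partial>PP)
    \<le> (\<integral>\<^sup>+x. (\<Prod>i<n. ennreal (root_ratio (f s) (f v) (x i))) * L t x \<partial>PP)"
    by (intro nn_integral_mono mult_right_mono)
       (auto simp: eq assms rejects_def split: split_indicator)
  also note prod_root_ratio_L_le[OF assms]
  finally show ?A .
  have "indicator (space PP - rejects s v) x \<le> (\<Prod>i<n. ennreal (root_ratio (f v) (f s) (x i)))"
    if x: "x \<in> space PP" for x
  proof (cases "x \<in> rejects s v")
    case False
    have "0 < ?r s v x" using pos[OF x] assms by (intro prod_pos) auto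
    moreover have "?r s v x < 1" using False x by (simp add: rejects_def)
    moreover have "?r v s x = 1 / ?r s v x"
      by (subst root_ratio_swap) (simp add: prod_dividef)
    ultimately have "1 \<le> ?r v s x" by simp
    then show ?thesis using x False by (simp add: eq assms)
  qed simp
  then have "(\<integral>\<^sup>+x. indicator (space PP - rejects s v) x * L t x \<partial>PP)
    \<le> (\<integral>\<^sup>+x. (\<Prod>i<n. ennreal (root_ratio (f v) (f s) (x i))) * L t x \<partial>PP)"
    by (intro nn_integral_mono mult_right_mono) auto
  also note prod_root_ratio_L_le[OF assms(2,1,3)]
  finally show ?B
    using Metric_space.commute[OF metric_h] by simp
qed

end

section \<open>The variational inequality for the Kullback-Leibler divergence\<close>

context sampled_model
begin

text \<open>When \<open>P\<close> is absolutely continuous with respect to \<open>P\<^sub>t\<close>, the two laws have densities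
with respect to \<open>\<mu>\<close>, and almost everywhere
\<open>g t\<close> is the reciprocal of \<open>dP / dP\<^sub>t\<close>. Uniqueness of densities is applied with respect to the
probability \<open>P\<close>, because it can fail with respect to \<open>\<mu>\<close>.\<close>
lemma RN_deriv_times_g:
  assumes t: "t \<in> S" and ac: "absolutely_continuous (model_dist \<mu> f t) P"
  shows "AE x in P. RN_deriv (model_dist \<mu> f t) P x * ennreal (g t x) = 1"
proof -
  define Pt where "Pt = model_dist \<mu> f t"
  interpret Pt: prob_space Pt unfolding Pt_def by (rule prob_model[OF t])
  interpret P: prob_space P by (rule prob_P)
  note [measurable] = f_measurable[OF t] p_measurable
  have [measurable_cong]: "sets Pt = sets \<mu>" by (simp add: Pt_def model_dist_def)
  let ?l = "RN_deriv Pt P"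
  have l: "density Pt ?l = P"
    using ac by (intro Pt.density_RN_deriv) (auto simp: Pt_def sets_P model_dist_def)
  have [measurable]: "?l \<in> borel_measurable \<mu>"
    using borel_measurable_RN_deriv[of Pt P] by (simp add: measurable_cong_sets[OF \<open>sets Pt = sets \<mu>\<close> refl])
  have [measurable]: "g t \<in> borel_measurable P" "g t \<in> borel_measurable \<mu>" unfolding g_def by measurable
  have "density P (\<lambda>x. ?l x * ennreal (g t x)) = density P (\<lambda>_. 1)"
  proof (rule measure_eqI)
    fix B assume "B \<in> sets (density P (\<lambda>x. ?l x * ennreal (g t x)))"
    then have [measurable]: "B \<in> sets \<mu>" by (simp add: sets_P)
    define A where "A = B \<inter> {x \<in> space \<mu>. 0 < p x}"
    have [measurable]: "A \<in> sets \<mu>" unfolding A_def by measurable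
    have "emeasure (density P (\<lambda>x. ?l x * ennreal (g t x))) B
        = (\<integral>\<^sup>+x. ennreal (p x) * (?l x * ennreal (g t x) * indicator B x) \<partial>\<mu>)"
      by (subst emeasure_density; (simp add: sets_P)?) (subst P_eq, subst nn_integral_density, auto)
    also have "\<dots> = (\<integral>\<^sup>+x. ennreal (f t x) * (?l x * indicator A x) \<partial>\<mu>)"
    proof (rule nn_integral_cong)
      fix x assume x: "x \<in> space \<mu>"
      show "ennreal (p x) * (?l x * ennreal (g t x) * indicator B x)
        = ennreal (f t x) * (?l x * indicator A x)"
      proof (cases "p x = 0")
        case False
        then have "ennreal (p x) * ennreal (g t x) = ennreal (f t x)"
          using p_nonneg[OF x] density_nonneg[OF t x] by (simp add: g_def ennreal_mult[symmetric])
        moreover have "indicator A x = (indicator B x :: ennreal)"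
          using x False p_nonneg[OF x] by (auto simp: A_def split: split_indicator)
        ultimately show ?thesis by (metis mult.assoc mult.left_commute)
      qed (simp add: A_def)
    qed
    also have "\<dots> = emeasure (density Pt ?l) A"
      unfolding Pt_def model_dist_def
      by (subst emeasure_density; simp?) (subst nn_integral_density; simp add: Pt_def[symmetric] model_dist_def[symmetric])
    also have "\<dots> = (\<integral>\<^sup>+x. ennreal (p x) * indicator A x \<partial>\<mu>)"
      unfolding l unfolding P_eq by (simp add: emeasure_density)
    also have "\<dots> = (\<integral>\<^sup>+x. ennreal (p x) * indicator B x \<partial>\<mu>)"
      by (rule nn_integral_cong) (use p_nonneg in \<open>auto simp: A_def less_le split: split_indicator\<close>)
    also have "\<dots> = emeasure (density P (\<lambda>_. 1)) B"
      by (simp add: density_1) (simp add: P_eq emeasure_density)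
    finally show "emeasure (density P (\<lambda>x. ?l x * ennreal (g t x))) B = emeasure (density P (\<lambda>_. 1)) B" .
  qed simp
  moreover have "?l \<in> borel_measurable P"
    using \<open>?l \<in> borel_measurable \<mu>\<close> by simp
  ultimately show ?thesis
    unfolding Pt_def[symmetric] by (subst (asm) P.density_unique_iff) auto
qed

lemma AE_PP_component: "AE x in P. Q x \<Longrightarrow> i < n \<Longrightarrow> AE x in PP. Q (x i)"
  by (rule AE_PiM_component) (auto intro: prob_P)

lemma integral_PP_component:
  fixes k :: "'x \<Rightarrow> real"
  assumes "integrable P k" "i < n"
  shows "integrable PP (\<lambda>x. k (x i))" "(\<integral>x. k (x i) \<partial>PP) = (\<integral>x. k x \<partial>P)"
proof -
  have d: "distr PP P (\<lambda>x. x i) = P"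
    using assms(2) by (intro distr_PiM_component) (auto intro: prob_P)
  have [measurable]: "(\<lambda>x. x i) \<in> PP \<rightarrow>\<^sub>M P" using assms(2) by simp
  show "integrable PP (\<lambda>x. k (x i))"
    by (rule integrable_distr[of "\<lambda>x. x i" PP P]) (simp_all add: d assms)
  have "(\<integral>x. k x \<partial>distr PP P (\<lambda>x. x i)) = (\<integral>x. k (x i) \<partial>PP)"
    by (rule integral_distr) (use assms in auto)
  then show "(\<integral>x. k (x i) \<partial>PP) = (\<integral>x. k x \<partial>P)" by (simp add: d)
qed

text \<open>This is the Donsker-Varadhan inequality for \<open>n\<close> observations in the linearised form obtained from
\<open>u + 1 \<le> exp u\<close>, applied pointwise to \<open>u = Y + log L\<^sub>t\<close> and integrated under the law of the sample.
Being linear in \<open>exp Y\<close>, it can be averaged over \<open>t\<close>.\<close>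
lemma kullback_variational:
  fixes Y :: "(nat \<Rightarrow> 'x) \<Rightarrow> real"
  assumes t: "t \<in> S" and Y: "integrable PP Y" and n: "0 < n"
  shows "ennreal ((\<integral>x. Y x \<partial>PP) + 1)
    \<le> of_nat n * kullback P (model_dist \<mu> f t) + (\<integral>\<^sup>+x. ennreal (exp (Y x)) * L t x \<partial>PP)"
proof (cases "kullback P (model_dist \<mu> f t) = \<infinity> \<or> (\<integral>\<^sup>+x. ennreal (exp (Y x)) * L t x \<partial>PP) = \<infinity>")
  case True
  then show ?thesis using n by (auto simp: ennreal_mult_eq_top_iff)
next
  case False
  define Pt where "Pt = model_dist \<mu> f t"
  define k where "k x = - ln (g t x)" for x
  interpret P: prob_space P by (rule prob_P)
  interpret PP: prob_space PP by (rule prob_space_PiM) (rule prob_P)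
  note [measurable] = f_measurable[OF t] p_measurable borel_measurable_integrable[OF Y]
  have [measurable]: "g t \<in> borel_measurable P" unfolding g_def by measurable
  have gcomp [measurable]: "(\<lambda>x. g t (x i)) \<in> borel_measurable PP" if "i \<in> {..<n}" for i
    using that by measurable
  have ac: "absolutely_continuous Pt P" and int: "integrable P (entropy_density (exp 1) Pt P)"
    and kb: "kullback P Pt = ennreal (KL_divergence (exp 1) Pt P)"
    using False unfolding kullback_def Pt_def by (auto split: if_splits)
  have rn: "AE x in P. 0 < g t x \<and> entropy_density (exp 1) Pt P x = k x"
    using RN_deriv_times_g[OF t ac[unfolded Pt_def]] unfolding Pt_def[symmetric]
  proof eventually_elim
    case (elim x)
    then have l: "RN_deriv Pt P x * ennreal (g t x) = 1" by simp
    then have g: "0 < g t x" by (metis ennreal_neg mult_zero_right not_less zero_neq_one)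
    from l have "enn2real (RN_deriv Pt P x) * g t x = 1"
      using g by (metis enn2real_1 enn2real_ennreal enn2real_mult less_imp_le)
    then have "enn2real (RN_deriv Pt P x) = 1 / g t x" using g by (simp add: field_simps)
    then show ?case using g by (simp add: entropy_density_def k_def log_def ln_div)
  qed
  have [measurable]: "k \<in> borel_measurable P" unfolding k_def by measurable
  have sPt: "sets Pt = sets P" by (simp add: Pt_def model_dist_def sets_P)
  have [measurable]: "entropy_density (exp 1) Pt P \<in> borel_measurable P"
    using measurable_entropy_density[of "exp 1" Pt P] by (simp add: measurable_cong_sets[OF sPt refl])
  have ik: "integrable P k"
    using int rn by (subst integrable_cong_AE[of _ _ "entropy_density (exp 1) Pt P"]) auto
  have KL: "KL_divergence (exp 1) Pt P = integral\<^sup>L P k"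
    unfolding KL_divergence_def using rn by (intro integral_cong_AE) auto
  define Z where "Z x = exp (Y x) * (\<Prod>i<n. g t (x i))" for x
  have [measurable]: "Z \<in> borel_measurable PP" unfolding Z_def by measurable
  have g_nn: "0 \<le> g t (x i)" if "x \<in> space PP" "i < n" for x i
  proof -
    have "x i \<in> space \<mu>" using that by (auto simp: space_PiM space_P)
    then show ?thesis using p_nonneg density_nonneg[OF t] by (simp add: g_def)
  qed
  have Z_nn: "0 \<le> Z x" if "x \<in> space PP" for x
    using g_nn[OF that] unfolding Z_def by (intro mult_nonneg_nonneg prod_nonneg) auto
  have Z_eq: "ennreal (exp (Y x)) * L t x = ennreal (Z x)" if "x \<in> space PP" for x
  proof -
    have "L t x = ennreal (\<Prod>i<n. g t (x i))"
      unfolding likelihood_def using g_nn[OF that] by (intro prod_ennreal) auto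
    moreover have "0 \<le> (\<Prod>i<n. g t (x i))"
      using g_nn[OF that] by (intro prod_nonneg) auto
    ultimately show ?thesis by (simp add: Z_def ennreal_mult)
  qed
  have ZL: "(\<integral>\<^sup>+x. ennreal (exp (Y x)) * L t x \<partial>PP) = (\<integral>\<^sup>+x. ennreal (Z x) \<partial>PP)"
    by (intro nn_integral_cong Z_eq)
  have iZ: "integrable PP Z"
    using False Z_nn ZL by (intro integrableI_nonneg) (auto simp: less_top)
  have "AE x in PP. \<forall>i\<in>{..<n}. 0 < g t (x i)"
    by (intro AE_finite_allI AE_PP_component) (use rn in auto)
  then have "AE x in PP. Y x + 1 \<le> (\<Sum>i<n. k (x i)) + Z x"
  proof eventually_elim
    case (elim x)
    define u where "u = Y x + (\<Sum>i<n. ln (g t (x i)))"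
    have "exp u = Z x" using elim by (simp add: u_def Z_def exp_add exp_sum)
    then show ?case using exp_ge_add_one_self[of u] by (simp add: u_def k_def sum_negf)
  qed
  moreover have iS: "integrable PP (\<lambda>x. \<Sum>i<n. k (x i))"
    by (rule Bochner_Integration.integrable_sum) (simp add: integral_PP_component(1)[OF ik])
  ultimately have "(\<integral>x. Y x + 1 \<partial>PP) \<le> (\<integral>x. (\<Sum>i<n. k (x i)) + Z x \<partial>PP)"
    using Y iZ by (intro integral_mono_AE) auto
  also have "\<dots> = (\<integral>x. (\<Sum>i<n. k (x i)) \<partial>PP) + integral\<^sup>L PP Z"
    by (rule Bochner_Integration.integral_add[OF iS iZ])
  also have "(\<integral>x. (\<Sum>i<n. k (x i)) \<partial>PP) = n * integral\<^sup>L P k"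
    by (subst Bochner_Integration.integral_sum) (simp_all add: integral_PP_component[OF ik])
  finally have "(\<integral>x. Y x \<partial>PP) + 1 \<le> n * integral\<^sup>L P k + integral\<^sup>L PP Z"
    using Y by (simp add: PP.prob_space)
  also have "\<dots> \<le> n * max 0 (integral\<^sup>L P k) + integral\<^sup>L PP Z"
    by (simp add: mult_left_mono)
  finally have "ennreal ((\<integral>x. Y x \<partial>PP) + 1) \<le> ennreal (n * max 0 (integral\<^sup>L P k) + integral\<^sup>L PP Z)"
    by (rule ennreal_leI)
  also have "\<dots> = of_nat n * ennreal (integral\<^sup>L P k) + ennreal (integral\<^sup>L PP Z)"
    using Z_nn by (subst ennreal_plus)
      (auto simp: ennreal_mult ennreal_of_nat_eq_real_of_nat max_def ennreal_neg intro!: integral_nonneg_AE)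
  also have "ennreal (integral\<^sup>L PP Z) = (\<integral>\<^sup>+x. ennreal (exp (Y x)) * L t x \<partial>PP)"
    unfolding ZL using iZ Z_nn by (intro nn_integral_eq_integral[symmetric]) auto
  finally show ?thesis using kb KL by (simp add: Pt_def)
qed

lemma prior_integral_L_measurable:
  assumes [measurable]: "A \<in> sets \<nu>"
  shows "(\<lambda>x. \<integral>\<^sup>+t\<in>A. L t x \<partial>\<nu>) \<in> borel_measurable PP"
proof -
  interpret prob_space \<nu> by (rule prob_prior)
  have "(\<lambda>(x, t). L t x * indicator A t) \<in> borel_measurable (PP \<Otimes>\<^sub>M \<nu>)"
    using measurable_pair_swap[OF L_measurable] by measurable
  then show ?thesis by (rule borel_measurable_nn_integral)
qed

lemma prior_integral_swap:
  assumes [measurable]: "A \<in> sets \<nu>" "\<phi> \<in> borel_measurable PP"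
  shows "(\<integral>\<^sup>+x. \<phi> x * (\<integral>\<^sup>+t\<in>A. L t x \<partial>\<nu>) \<partial>PP) = (\<integral>\<^sup>+t\<in>A. (\<integral>\<^sup>+x. \<phi> x * L t x \<partial>PP) \<partial>\<nu>)"
    and "(\<lambda>t. \<integral>\<^sup>+x. \<phi> x * L t x \<partial>PP) \<in> borel_measurable \<nu>"
proof -
  interpret nu: prob_space \<nu> by (rule prob_prior)
  interpret PP: prob_space PP by (rule prob_space_PiM) (rule prob_P)
  interpret pair_sigma_finite \<nu> PP by unfold_locales
  have [measurable]: "(\<lambda>(t, x). \<phi> x * L t x) \<in> borel_measurable (\<nu> \<Otimes>\<^sub>M PP)"
    by measurable
  show m: "(\<lambda>t. \<integral>\<^sup>+x. \<phi> x * L t x \<partial>PP) \<in> borel_measurable \<nu>" by measurable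
  have Lx: "(\<lambda>t. L t x) \<in> borel_measurable \<nu>" if "x \<in> space PP" for x
    using measurable_Pair1[OF L_measurable that] by simp
  have "(\<integral>\<^sup>+x. \<phi> x * (\<integral>\<^sup>+t\<in>A. L t x \<partial>\<nu>) \<partial>PP) = (\<integral>\<^sup>+x. \<integral>\<^sup>+t. \<phi> x * L t x * indicator A t \<partial>\<nu> \<partial>PP)"
    by (intro nn_integral_cong) (use Lx in \<open>simp add: nn_integral_cmult[symmetric] mult.assoc\<close>)
  also have "\<dots> = (\<integral>\<^sup>+t. \<integral>\<^sup>+x. \<phi> x * L t x * indicator A t \<partial>PP \<partial>\<nu>)"
    by (rule Fubini') measurable
  also have "\<dots> = (\<integral>\<^sup>+t\<in>A. (\<integral>\<^sup>+x. \<phi> x * L t x \<partial>PP) \<partial>\<nu>)"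
  proof (rule nn_integral_cong)
    fix t assume "t \<in> space \<nu>"
    then have [measurable]: "L t \<in> borel_measurable PP" by (simp add: space_prior)
    show "(\<integral>\<^sup>+x. \<phi> x * L t x * indicator A t \<partial>PP) = (\<integral>\<^sup>+x. \<phi> x * L t x \<partial>PP) * indicator A t"
      by (rule nn_integral_multc) measurable
  qed
  finally show "(\<integral>\<^sup>+x. \<phi> x * (\<integral>\<^sup>+t\<in>A. L t x \<partial>\<nu>) \<partial>PP) = (\<integral>\<^sup>+t\<in>A. (\<integral>\<^sup>+x. \<phi> x * L t x \<partial>PP) \<partial>\<nu>)" .
qed

text \<open>The variational inequality for the mixture of the product laws over \<open>B\<close>, up to normalisation by \<open>\<nu> B\<close>.
The divergence may fail to be measurable in \<open>t\<close>, so its integral is bounded below by that of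
the measurable minorant \<open>(a - b t) / n\<close>.\<close>
lemma averaged_kullback_variational:
  fixes Y :: "(nat \<Rightarrow> 'x) \<Rightarrow> real"
  assumes Y: "integrable PP Y" and n: "0 < n" and B [measurable]: "B \<in> sets \<nu>"
  shows "ennreal ((\<integral>x. Y x \<partial>PP) + 1) * emeasure \<nu> B
    \<le> of_nat n * (\<integral>\<^sup>+t\<in>B. kullback P (model_dist \<mu> f t) \<partial>\<nu>)
      + (\<integral>\<^sup>+x. ennreal (exp (Y x)) * (\<integral>\<^sup>+t\<in>B. L t x \<partial>\<nu>) \<partial>PP)"
proof -
  define a where "a = ennreal ((\<integral>x. Y x \<partial>PP) + 1)"
  define b where "b t = (\<integral>\<^sup>+x. ennreal (exp (Y x)) * L t x \<partial>PP)" for t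
  have [measurable]: "(\<lambda>x. ennreal (exp (Y x))) \<in> borel_measurable PP"
    using borel_measurable_integrable[OF Y] by measurable
  note swap = prior_integral_swap[OF B this, folded b_def]
  note [measurable] = swap(2)
  let ?d = "\<lambda>t. (a - b t) / of_nat n"
  have n0: "of_nat n * (x / of_nat n) = x" for x :: ennreal
    using n by (simp add: ennreal_times_divide ennreal_divide_self mult.commute[of "of_nat n"]
      mult_divide_eq_ennreal)
  have "a * emeasure \<nu> B = (\<integral>\<^sup>+t\<in>B. a \<partial>\<nu>)" by (simp add: nn_integral_cmult_indicator)
  also have "\<dots> \<le> (\<integral>\<^sup>+t. of_nat n * (?d t * indicator B t) + b t * indicator B t \<partial>\<nu>)"
  proof (intro nn_integral_mono)
    fix t
    have "a \<le> (a - b t) + b t"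
      by (cases "b t \<le> a") (simp_all add: diff_add_cancel_ennreal add_increasing)
    then show "a * indicator B t \<le> of_nat n * (?d t * indicator B t) + b t * indicator B t"
      by (auto simp: n0 split: split_indicator)
  qed
  also have "\<dots> = of_nat n * (\<integral>\<^sup>+t\<in>B. ?d t \<partial>\<nu>) + (\<integral>\<^sup>+t\<in>B. b t \<partial>\<nu>)"
    by (subst nn_integral_add) (auto simp: nn_integral_cmult)
  also have "(\<integral>\<^sup>+t\<in>B. ?d t \<partial>\<nu>) \<le> (\<integral>\<^sup>+t\<in>B. kullback P (model_dist \<mu> f t) \<partial>\<nu>)"
  proof (intro nn_integral_mono mult_right_mono)
    fix t assume "t \<in> space \<nu>"
    then have "a \<le> of_nat n * kullback P (model_dist \<mu> f t) + b t"
      using kullback_variational[OF _ Y n] by (simp add: space_prior a_def b_def)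
    then have "a - b t \<le> of_nat n * kullback P (model_dist \<mu> f t)"
      by (simp add: ennreal_minus_le_iff add.commute a_def)
    then show "?d t \<le> kullback P (model_dist \<mu> f t)"
      using n by (metis divide_le_posI_ennreal ennreal_of_nat_eq_real_of_nat ennreal_less_zero_iff of_nat_0_less_iff)
  qed simp
  finally show ?thesis
    by (simp add: a_def swap(1) mult_left_mono add_right_mono)
qed

end

section \<open>Nets and separated sets\<close>

text \<open>A separated set of maximal cardinality is a net.\<close>
lemma (in Metric_space) separated_net:
  assumes "B \<subseteq> M" "0 \<le> x"
    and bounded: "\<And>N. N \<subseteq> B \<Longrightarrow> separated d x N \<Longrightarrow> finite N \<and> real (card N) \<le> c"
  obtains N where "N \<subseteq> B" "finite N" "real (card N) \<le> c" "\<And>u. u \<in> B \<Longrightarrow> \<exists>v\<in>N. d u v \<le> x"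
proof -
  let ?Q = "\<lambda>N. N \<subseteq> B \<and> separated d x N"
  have "?Q {}" by (simp add: separated_def)
  moreover have "\<forall>N. ?Q N \<longrightarrow> card N < Suc (nat \<lfloor>c\<rfloor>)"
    using bounded by (simp add: less_Suc_eq_le le_nat_floor)
  ultimately have "\<exists>N. ?Q N \<and> (\<forall>N'. ?Q N' \<longrightarrow> card N' \<le> card N)"
    by (rule ex_has_greatest_nat)
  then obtain N where N: "N \<subseteq> B" "separated d x N" and max: "\<And>N'. ?Q N' \<Longrightarrow> card N' \<le> card N"
    by blast
  have fin: "finite N" using bounded N by blast
  show thesis
  proof (rule that)
    fix u assume u: "u \<in> B"
    show "\<exists>v\<in>N. d u v \<le> x"
    proof (rule ccontr)
      assume "\<not> (\<exists>v\<in>N. d u v \<le> x)"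
      then have far: "\<And>v. v \<in> N \<Longrightarrow> x < d u v" by (simp add: not_le)
      then have "u \<notin> N" using u assms(1,2) by force
      moreover have "separated d x (insert u N)"
        using N(2) far by (auto simp: separated_def commute)
      then have "card (insert u N) \<le> card N" using max[of "insert u N"] N(1) u by blast
      ultimately show False using fin by simp
    qed
  qed (use N fin bounded in blast)+
qed

text \<open>The covering hypothesis refines a ball by a factor 4 only. A second refinement gives the factor 16 that makes
the cells small enough, compared with their distance to \<open>s\<close>, for the robust test.\<close>
lemma (in Metric_space) two_scale_net:
  assumes cov: "\<And>x t N. x \<in> {0<..1/4} \<Longrightarrow> t \<in> M \<Longrightarrow> N \<subseteq> mcball t (4 * x) \<Longrightarrow> separated d x N \<Longrightarrow>
      finite N \<and> real (card N) \<le> exp (D x)"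
    and s: "s \<in> M" and \<rho>: "0 < \<rho>" "\<rho> \<le> 1"
  obtains N where "N \<subseteq> M" "finite N" "real (card N) \<le> exp (D (\<rho> / 4) + D (\<rho> / 16))"
    "\<And>u. u \<in> mcball s \<rho> \<Longrightarrow> \<exists>v\<in>N. d u v \<le> \<rho> / 16"
proof -
  have net: "\<exists>N. N \<subseteq> M \<and> finite N \<and> real (card N) \<le> exp (D x)
      \<and> (\<forall>u\<in>mcball t r. \<exists>v\<in>N. d u v \<le> x)"
    if "t \<in> M" "x \<in> {0<..1/4}" "r = 4 * x" for x t r
  proof -
    have "0 \<le> x" using that by simp
    show ?thesis
    proof (rule separated_net[OF mcball_subset_mspace \<open>0 \<le> x\<close> cov[OF that(2,1)]])
      fix N assume "N \<subseteq> mcball t (4 * x)" "finite N" "real (card N) \<le> exp (D x)"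
        "\<And>u. u \<in> mcball t (4 * x) \<Longrightarrow> \<exists>v\<in>N. d u v \<le> x"
      then show ?thesis unfolding that(3)
        by (intro exI[of _ N] conjI order_trans[OF _ mcball_subset_mspace]) blast+
    qed
  qed
  have "\<exists>N. N \<subseteq> M \<and> finite N \<and> real (card N) \<le> exp (D (\<rho> / 4))
      \<and> (\<forall>u\<in>mcball s \<rho>. \<exists>v\<in>N. d u v \<le> \<rho> / 4)"
    using s \<rho> by (intro net) simp_all
  then obtain N1 where N1: "N1 \<subseteq> M" "finite N1" "real (card N1) \<le> exp (D (\<rho> / 4))"
    "\<And>u. u \<in> mcball s \<rho> \<Longrightarrow> \<exists>v\<in>N1. d u v \<le> \<rho> / 4"
    by blast
  have "\<exists>N. N \<subseteq> M \<and> finite N \<and> real (card N) \<le> exp (D (\<rho> / 16))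
      \<and> (\<forall>u\<in>mcball v (\<rho> / 4). \<exists>v'\<in>N. d u v' \<le> \<rho> / 16)" if "v \<in> N1" for v
    using \<rho> that N1(1) by (intro net) (simp_all add: subsetD)
  then have "\<forall>v\<in>N1. \<exists>N. N \<subseteq> M \<and> finite N \<and> real (card N) \<le> exp (D (\<rho> / 16))
      \<and> (\<forall>u\<in>mcball v (\<rho> / 4). \<exists>v'\<in>N. d u v' \<le> \<rho> / 16)" by blast
  from bchoice[OF this] obtain net2 where net2: "\<And>v. v \<in> N1 \<Longrightarrow>
      net2 v \<subseteq> M \<and> finite (net2 v) \<and> real (card (net2 v)) \<le> exp (D (\<rho> / 16))
      \<and> (\<forall>u\<in>mcball v (\<rho> / 4). \<exists>v'\<in>net2 v. d u v' \<le> \<rho> / 16)" by blast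
  have N2: "net2 v \<subseteq> M" "finite (net2 v)" "real (card (net2 v)) \<le> exp (D (\<rho> / 16))"
    "\<And>u. u \<in> mcball v (\<rho> / 4) \<Longrightarrow> \<exists>v'\<in>net2 v. d u v' \<le> \<rho> / 16" if "v \<in> N1" for v
    using net2[OF that] by blast+
  show thesis
  proof (rule that[of "\<Union>v\<in>N1. net2 v"])
    have "real (card (\<Union>v\<in>N1. net2 v)) \<le> (\<Sum>v\<in>N1. real (card (net2 v)))"
      using card_UN_le[OF N1(2), of net2] by (simp flip: of_nat_sum)
    also have "\<dots> \<le> real (card N1) * exp (D (\<rho> / 16))"
      using sum_bounded_above[of N1, OF N2(3)] by simp
    also have "\<dots> \<le> exp (D (\<rho> / 4)) * exp (D (\<rho> / 16))"
      using N1(3) by (intro mult_right_mono) auto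
    finally show "real (card (\<Union>v\<in>N1. net2 v)) \<le> exp (D (\<rho> / 4) + D (\<rho> / 16))"
      by (simp add: exp_add)
  next
    fix u assume u: "u \<in> mcball s \<rho>"
    then obtain v where v: "v \<in> N1" "d u v \<le> \<rho> / 4" using N1(4) by blast
    then have "u \<in> mcball v (\<rho> / 4)" using u N1(1) by (auto simp: commute)
    then show "\<exists>v\<in>\<Union>v\<in>N1. net2 v. d u v \<le> \<rho> / 16" using N2(4)[OF v(1)] v(1) by blast
  qed (use N1 N2 in auto)
qed

section \<open>Minimizers of the expected loss\<close>

text \<open>The growth condition compares \<open>w\<close> only at arguments whose ratio is at least 2, so \<open>w\<close> may oscillate at smaller
ratios; every comparison below leaves a gap of that size.\<close>
locale growing_loss =
  fixes w :: "real \<Rightarrow> real" and \<delta> a b :: real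
  assumes \<delta>_pos: "0 < \<delta>" and a_pos: "0 < a" and b_pos: "0 < b"
    and w_0: "w 0 = 0" and w_nontrivial: "\<exists>z\<in>{0..1}. w z \<noteq> 0"
    and growth: "\<And>z x. z \<in> {0<..1/2} \<Longrightarrow> 2 \<le> x \<Longrightarrow> x \<le> 1 / z \<Longrightarrow>
      x powr \<delta> * w z \<le> w (x * z) \<and> w (x * z) \<le> a * exp (b * x\<^sup>2) * w z"
begin

lemma growth_lower: "0 < z \<Longrightarrow> 2 * z \<le> y \<Longrightarrow> y \<le> 1 \<Longrightarrow> (y / z) powr \<delta> * w z \<le> w y"
  and growth_upper: "0 < z \<Longrightarrow> 2 * z \<le> y \<Longrightarrow> y \<le> 1 \<Longrightarrow> w y \<le> a * exp (b * (y / z)\<^sup>2) * w z"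
  using growth[of z "y / z"] by (auto simp: field_simps)

lemma exponential_dominates: "\<exists>x\<ge>2. x powr \<delta> < a * exp (b * x\<^sup>2)"
proof -
  define c where "c = \<delta> + \<bar>ln a\<bar> + 1"
  define x where "x = max 2 (c / b)"
  have x: "2 \<le> x" "c \<le> b * x" using b_pos by (auto simp: x_def field_simps max_def)
  have "c * x \<le> b * x * x" using x by (intro mult_right_mono) auto
  moreover have "\<bar>ln a\<bar> * 1 \<le> \<bar>ln a\<bar> * x"
    using x by (intro mult_left_mono) auto
  then have "\<delta> * x + \<bar>ln a\<bar> * 1 + 1 \<le> c * x"
    unfolding c_def distrib_right using x by linarith
  ultimately have "\<delta> * x < ln a + b * x\<^sup>2" by (simp add: power2_eq_square)
  moreover have "\<delta> * ln x \<le> \<delta> * x"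
    using x ln_le_minus_one[of x] \<delta>_pos by (intro mult_left_mono) auto
  ultimately have "exp (\<delta> * ln x) < exp (ln a + b * x\<^sup>2)" by simp
  then have "x powr \<delta> < a * exp (b * x\<^sup>2)"
    using x a_pos by (simp add: powr_def exp_add)
  with x show ?thesis by blast
qed

text \<open>A negative value at \<open>z\<close> would propagate to \<open>z / x\<close> for every \<open>x \<ge> 2\<close>, where the two growth bounds have
the wrong order as soon as \<open>a * exp (b * x\<^sup>2) > x powr \<delta>\<close>.\<close>
lemma w_nonneg:
  assumes z: "0 \<le> z" "z \<le> 1"
  shows "0 \<le> w z"
proof (rule ccontr)
  assume "\<not> 0 \<le> w z"
  then have neg: "w z < 0" "0 < z" using z w_0 by (auto simp: less_le)
  obtain x where x: "2 \<le> x" "x powr \<delta> < a * exp (b * x\<^sup>2)" using exponential_dominates by blast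
  define y where "y = z / x"
  have y: "0 < y" "2 * y \<le> z" "z / y = x" using neg x by (auto simp: y_def field_simps)
  have lo: "x powr \<delta> * w y \<le> w z" and hi: "w z \<le> a * exp (b * x\<^sup>2) * w y"
    using growth_lower[OF y(1,2) z(2)] growth_upper[OF y(1,2) z(2)] by (simp_all add: y)
  have "w y < 0"
  proof (rule ccontr)
    assume "\<not> w y < 0"
    then have "0 \<le> x powr \<delta> * w y" by simp
    with lo neg show False by linarith
  qed
  with x have "a * exp (b * x\<^sup>2) * w y < x powr \<delta> * w y" by (intro mult_strict_right_mono_neg)
  with lo hi show False by linarith
qed

lemma w_pos:
  assumes z: "0 < z" "z \<le> 1"
  shows "0 < w z"
proof -
  obtain v where "v \<in> {0..1}" "w v \<noteq> 0" using w_nontrivial by blast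
  then have v: "0 < v" "v \<le> 1" "0 < w v" using w_nonneg[of v] w_0 by (auto simp: less_le)
  define y where "y = min z v / 2"
  have y: "0 < y" "2 * y \<le> z" "2 * y \<le> v" using z v by (auto simp: y_def)
  have "0 < w y"
  proof (rule ccontr)
    assume "\<not> 0 < w y"
    then have "a * exp (b * (v / y)\<^sup>2) * w y \<le> 0" using a_pos by (simp add: mult_le_0_iff)
    then show False using growth_upper[OF y(1,3) v(2)] v(3) by linarith
  qed
  then have "0 < (z / y) powr \<delta> * w y" using y z by simp
  then show ?thesis using growth_lower[OF y(1,2) z(2)] by linarith
qed

lemma w_doubling: "0 \<le> z \<Longrightarrow> 2 * z \<le> y \<Longrightarrow> y \<le> 1 \<Longrightarrow> w z \<le> w y"
proof -
  assume z: "0 \<le> z" "2 * z \<le> y" "y \<le> 1"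
  show "w z \<le> w y"
  proof (cases "z = 0")
    case False
    have "1 * w z \<le> (y / z) powr \<delta> * w z"
      using z False w_nonneg[of z] \<delta>_pos by (intro mult_right_mono ge_one_powr_ge_zero) auto
    also have "\<dots> \<le> w y" using growth_lower[of z y] z False by simp
    finally show ?thesis by simp
  qed (use z w_nonneg w_0 in auto)
qed

text \<open>The upper growth bound is applied from \<open>r / 2\<close>, which is admissible as \<open>z > r\<close>, and \<open>w (r / 2)\<close> is then
replaced by \<open>w (2 * r)\<close>, the reference value used for all arguments.\<close>
lemma w_tail:
  assumes r: "0 < r" "r \<le> 1 / 2" and z: "r < z" "z \<le> 1"
  shows "w z \<le> a * exp (4 * b * z\<^sup>2 / r\<^sup>2) * w (2 * r)"
proof -
  have "w z \<le> a * exp (b * (z / (r / 2))\<^sup>2) * w (r / 2)"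
    using r z by (intro growth_upper) auto
  also have "\<dots> \<le> a * exp (b * (z / (r / 2))\<^sup>2) * w (2 * r)"
    using r a_pos by (intro mult_left_mono w_doubling) auto
  also have "b * (z / (r / 2))\<^sup>2 = 4 * b * z\<^sup>2 / r\<^sup>2" by (simp add: power2_eq_square)
  finally show ?thesis .
qed

text \<open>Let \<open>x = (5 / 4 * (1 + a / 2)) powr (1 / \<delta>)\<close>. If \<open>\<pi>\<close> concentrates on the ball of radius \<open>r\<close> around \<open>s\<close>, with exponentially weighted tails, then the
expected loss at \<open>s\<close> is less than \<open>(1 + a / 2) * w (2 * r)\<close>. At a point \<open>e\<close> farther than
\<open>4 * (x + 1) * r\<close> from \<open>s\<close> the loss on the ball is at least \<open>x powr \<delta> * w (2 * r)\<close>, and the ball has mass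
at least \<open>4 / 5\<close>. The choice of \<open>x\<close> makes these bounds contradictory if \<open>e\<close> is a minimizer.\<close>
lemma minimizer_near_concentration_point:
  assumes "Metric_space M d" and d1: "\<And>t u. t \<in> M \<Longrightarrow> u \<in> M \<Longrightarrow> d t u \<le> 1"
    and w_meas: "w \<in> borel_measurable (restrict_space borel {0..1})"
    and "prob_space \<pi>" and sp: "space \<pi> = M"
    and d_meas: "\<And>u. u \<in> M \<Longrightarrow> d u \<in> borel_measurable \<pi>"
    and s: "s \<in> M" and e: "e \<in> M"
    and min: "(\<integral>t. w (d e t) \<partial>\<pi>) \<le> (\<integral>t. w (d s t) \<partial>\<pi>)"
    and r: "0 < r" "r \<le> 1 / 4"
    and tail: "(\<integral>\<^sup>+t. ennreal (if r < d s t then exp (4 * b * (d s t)\<^sup>2 / r\<^sup>2) else 0) \<partial>\<pi>) \<le> ennreal (1 / 5)"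
  shows "d e s \<le> 4 * ((5 / 4 * (1 + a / 2)) powr (1 / \<delta>) + 1) * r"
proof (rule ccontr)
  interpret Metric_space M d by fact
  interpret \<pi>: prob_space \<pi> by fact
  define x where "x = (5 / 4 * (1 + a / 2)) powr (1 / \<delta>)"
  define k where "k t = (if r < d s t then exp (4 * b * (d s t)\<^sup>2 / r\<^sup>2) else 0)" for t
  assume "\<not> d e s \<le> 4 * ((5 / 4 * (1 + a / 2)) powr (1 / \<delta>) + 1) * r"
  then have far: "4 * (x + 1) * r < d e s" by (simp add: x_def)
  have x: "1 \<le> x" unfolding x_def using a_pos \<delta>_pos by (intro ge_one_powr_ge_zero) auto
  have x_powr: "x powr \<delta> = 5 / 4 * (1 + a / 2)"
    unfolding x_def using a_pos \<delta>_pos by (simp add: powr_powr)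
  define W where "W = w (2 * r)"
  have W: "0 < W" unfolding W_def using r by (intro w_pos) auto
  note [measurable] = d_meas[OF s] d_meas[OF e]
  have k_meas [measurable]: "k \<in> borel_measurable \<pi>" unfolding k_def by measurable
  have k_nn: "0 \<le> k t" for t by (simp add: k_def)
  have ik: "integrable \<pi> k" and k_int: "integral\<^sup>L \<pi> k \<le> 1 / 5"
  proof -
    show "integrable \<pi> k"
      using tail k_nn by (intro integrableI_nonneg) (auto simp: k_def[symmetric] intro: le_less_trans)
    then have "ennreal (integral\<^sup>L \<pi> k) \<le> ennreal (1 / 5)"
      using tail k_nn by (simp add: nn_integral_eq_integral k_def[symmetric])
    then show "integral\<^sup>L \<pi> k \<le> 1 / 5" by (subst (asm) ennreal_le_iff) auto
  qed
  have w_le: "w z \<le> W + a * exp (4 * b / r\<^sup>2) * W" if z: "0 \<le> z" "z \<le> 1" for z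
  proof (cases "z \<le> r")
    case True
    then have "w z \<le> W" unfolding W_def using r z by (intro w_doubling) auto
    moreover have "0 \<le> a * exp (4 * b / r\<^sup>2) * W" using a_pos W by simp
    ultimately show ?thesis by linarith
  next
    case False
    have "w z \<le> a * exp (4 * b * z\<^sup>2 / r\<^sup>2) * W"
      unfolding W_def using r z False by (intro w_tail) auto
    also have "\<dots> \<le> a * exp (4 * b / r\<^sup>2) * W"
      using a_pos W b_pos z by (intro mult_right_mono mult_left_mono)
        (auto intro!: divide_right_mono mult_left_le simp: power_le_one)
    finally show ?thesis using W by linarith
  qed
  have iw: "integrable \<pi> (\<lambda>t. w (d u t))" if u: "u \<in> M" for u
  proof (rule \<pi>.integrable_const_bound)
    have dr: "d u t \<in> {0..1}" if "t \<in> space \<pi>" for t using that u sp d1 by auto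
    then show "AE t in \<pi>. norm (w (d u t)) \<le> W + a * exp (4 * b / r\<^sup>2) * W"
      using w_le w_nonneg by (intro AE_I2) auto
    have "d u \<in> measurable \<pi> (restrict_space borel {0..1})"
      using dr d_meas[OF u] by (intro measurable_restrict_space2) auto
    then show "(\<lambda>t. w (d u t)) \<in> borel_measurable \<pi>"
      using w_meas by (rule measurable_compose)
  qed
  have "(\<integral>t. w (d s t) \<partial>\<pi>) \<le> (\<integral>t. W + a * W * k t \<partial>\<pi>)"
  proof (intro integral_mono)
    fix t assume t: "t \<in> space \<pi>"
    have dt: "0 \<le> d s t" "d s t \<le> 1" using t sp s d1 by auto
    show "w (d s t) \<le> W + a * W * k t"
    proof (cases "r < d s t")
      case True
      have "w (d s t) \<le> a * k t * W"
        using w_tail[of r "d s t"] True r dt by (simp add: k_def W_def)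
      then show ?thesis using W by (simp add: ac_simps)
    next
      case False
      then have "w (d s t) \<le> W" unfolding W_def using r dt by (intro w_doubling) auto
      then show ?thesis using False by (simp add: k_def)
    qed
  qed (use iw[OF s] ik in auto)
  also have "\<dots> = W + a * W * integral\<^sup>L \<pi> k" using ik by (simp add: \<pi>.prob_space)
  also have "\<dots> \<le> W + a * W * (1 / 5)"
    using k_int a_pos W by (intro add_left_mono mult_left_mono) auto
  finally have upper: "(\<integral>t. w (d s t) \<partial>\<pi>) \<le> W * (1 + a / 5)" by (simp add: algebra_simps)
  define c where "c = x powr \<delta> * W"
  have c: "0 < c" using W x by (simp add: c_def)
  have "c * (4 / 5) \<le> c * (1 - integral\<^sup>L \<pi> k)" using c k_int by simp
  also have "\<dots> = (\<integral>t. c * (1 - k t) \<partial>\<pi>)" using ik by (simp add: \<pi>.prob_space)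
  also have "\<dots> \<le> (\<integral>t. w (d e t) \<partial>\<pi>)"
  proof (intro integral_mono)
    fix t assume t: "t \<in> space \<pi>"
    have dt: "0 \<le> d e t" "d e t \<le> 1" using t sp e d1 by auto
    show "c * (1 - k t) \<le> w (d e t)"
    proof (cases "r < d s t")
      case True
      then have "1 \<le> k t" using b_pos by (simp add: k_def)
      then have "c * (1 - k t) \<le> 0" using c by (simp add: mult_le_0_iff)
      then show ?thesis using w_nonneg[OF dt] by linarith
    next
      case False
      have "d e s \<le> d e t + d t s" using triangle[of e t s] e s t sp by auto
      then have *: "(4 * x + 3) * r \<le> d e t" using far False commute[of s t] r
        by (simp add: algebra_simps)
      have "7 * r \<le> (4 * x + 3) * r" using x r by (intro mult_right_mono) auto
      then have "2 * (2 * r) \<le> d e t" using * r by linarith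
      then have low: "(d e t / (2 * r)) powr \<delta> * W \<le> w (d e t)"
        unfolding W_def using r dt by (intro growth_lower) auto
      have "x * (2 * r) \<le> (4 * x + 3) * r" using x r by (simp add: algebra_simps)
      then have "x * (2 * r) \<le> d e t" using * by linarith
      then have "x \<le> d e t / (2 * r)" using r by (simp add: pos_le_divide_eq)
      then have "c \<le> (d e t / (2 * r)) powr \<delta> * W"
        unfolding c_def using W x \<delta>_pos by (intro mult_right_mono powr_mono2) auto
      with low show ?thesis using False by (simp add: k_def)
    qed
  qed (use iw[OF e] ik in auto)
  also have "\<dots> \<le> W * (1 + a / 5)" using min upper by linarith
  finally have "W * (1 + a / 2) \<le> W * (1 + a / 5)" by (simp add: c_def x_powr algebra_simps)
  then have "1 + a / 2 \<le> 1 + a / 5" using W by simp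
  then show False using a_pos by simp
qed

end

section \<open>Testing a small ball against a shell\<close>

context sampled_model
begin

text \<open>One robust test for each cell of a net of the shell; \<open>F\<close> is the event that one of them rejects. A cell has radius
\<open>\<rho> / 16\<close> and its centre is at distance at least \<open>\<rho> / 2 - \<rho> / 16 = 7 / 16 * \<rho>\<close> from \<open>s\<close>, so each test has
exponent \<open>n * \<rho>\<^sup>2 * (49 / 256 - 8 / 256) / 3\<close>. The number of cells matters on the small ball only.\<close>
lemma shell_test:
  fixes \<rho> :: real
  assumes cov: "\<And>x t N. x \<in> {0<..1/4} \<Longrightarrow> t \<in> S \<Longrightarrow> N \<subseteq> hball \<mu> f S t (4 * x) \<Longrightarrow>
      separated h x N \<Longrightarrow> finite N \<and> real (card N) \<le> exp (D x)"
    and s: "s \<in> S" and \<rho>: "0 < \<rho>" "\<rho> \<le> 1"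
  obtains F where "F \<in> sets PP"
    "\<And>t. t \<in> S \<Longrightarrow> h s t \<le> \<rho> / 64 \<Longrightarrow> (\<integral>\<^sup>+x. indicator F x * L t x \<partial>PP)
        \<le> ennreal (exp (D (\<rho> / 4) + D (\<rho> / 16) - 41 / 768 * (n * \<rho>\<^sup>2)))"
    "\<And>t. t \<in> S \<Longrightarrow> \<rho> / 2 < h s t \<Longrightarrow> h s t \<le> \<rho> \<Longrightarrow>
      (\<integral>\<^sup>+x. indicator (space PP - F) x * L t x \<partial>PP) \<le> ennreal (exp (- 41 / 768 * (n * \<rho>\<^sup>2)))"
proof -
  interpret Metric_space S h by (rule metric_h)
  obtain N0 where N0: "N0 \<subseteq> S" "finite N0" "real (card N0) \<le> exp (D (\<rho> / 4) + D (\<rho> / 16))"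
    "\<And>u. u \<in> mcball s \<rho> \<Longrightarrow> \<exists>v\<in>N0. h u v \<le> \<rho> / 16"
    by (rule two_scale_net[of D s \<rho>]) (use cov s \<rho> in auto)
  define N where "N = {v \<in> N0. 7 / 16 * \<rho> \<le> h s v}"
  have N: "N \<subseteq> S" "finite N" using N0 by (auto simp: N_def)
  have cN: "real (card N) \<le> exp (D (\<rho> / 4) + D (\<rho> / 16))"
    using card_mono[OF N0(2), of N] N0(3) by (auto simp: N_def intro: order_trans[rotated])
  have sqv: "49 / 256 * \<rho>\<^sup>2 \<le> (h s v)\<^sup>2" if "v \<in> N" for v
  proof -
    have "(7 / 16 * \<rho>)\<^sup>2 \<le> (h s v)\<^sup>2" using that \<rho> by (intro power_mono) (auto simp: N_def)
    then show ?thesis by (simp add: power_mult_distrib power_divide)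
  qed
  have sqt: "(h t u)\<^sup>2 \<le> 1 / 256 * \<rho>\<^sup>2" if "h t u \<le> \<rho> / 16" for t u
    using power_mono[OF that, of 2] by (simp add: power_divide)
  have bound: "exp (- (n * (A - 8 * E) / 3)) \<le> exp (- 41 / 768 * (n * \<rho>\<^sup>2))"
    if "49 / 256 * \<rho>\<^sup>2 \<le> A" "E \<le> 1 / 256 * \<rho>\<^sup>2" for A E :: real
  proof -
    have "n * (41 / 256 * \<rho>\<^sup>2) \<le> n * (A - 8 * E)" using that by (intro mult_left_mono) auto
    then show ?thesis by simp
  qed
  define F where "F = (\<Union>v\<in>N. rejects s v)"
  show thesis
  proof (rule that)
    show "F \<in> sets PP" unfolding F_def
      using N s by (intro sets.finite_UN) (auto intro!: rejects_sets)
  next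
    fix t assume t: "t \<in> S" "h s t \<le> \<rho> / 64"
    note [measurable] = L_measurable1[OF t(1)] rejects_sets[OF s]
    have "(\<integral>\<^sup>+x. indicator F x * L t x \<partial>PP) \<le> (\<integral>\<^sup>+x. (\<Sum>v\<in>N. indicator (rejects s v) x * L t x) \<partial>PP)"
    proof (rule nn_integral_mono)
      fix x
      show "indicator F x * L t x \<le> (\<Sum>v\<in>N. indicator (rejects s v) x * L t x)"
      proof (cases "x \<in> F")
        case True
        then obtain v where v: "v \<in> N" "x \<in> rejects s v" by (auto simp: F_def)
        then have "indicator F x * L t x = indicator (rejects s v) x * L t x" using True by simp
        also have "\<dots> \<le> (\<Sum>v\<in>N. indicator (rejects s v) x * L t x)"
          using v N by (intro member_le_sum) auto
        finally show ?thesis .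
      qed simp
    qed
    also have "\<dots> = (\<Sum>v\<in>N. \<integral>\<^sup>+x. indicator (rejects s v) x * L t x \<partial>PP)"
      using N by (intro nn_integral_sum) auto
    also have "\<dots> \<le> (\<Sum>v\<in>N. ennreal (exp (- 41 / 768 * (n * \<rho>\<^sup>2))))"
    proof (rule sum_mono)
      fix v assume v: "v \<in> N"
      have "h t s \<le> \<rho> / 16" using t \<rho> by (simp add: commute)
      from bound[OF sqv[OF v] sqt[OF this]]
      show "(\<integral>\<^sup>+x. indicator (rejects s v) x * L t x \<partial>PP) \<le> ennreal (exp (- 41 / 768 * (n * \<rho>\<^sup>2)))"
        using v N s t by (intro order_trans[OF test_error(1)] ennreal_leI) auto
    qed
    also have "\<dots> = ennreal (real (card N) * exp (- 41 / 768 * (n * \<rho>\<^sup>2)))"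
      by (simp add: ennreal_mult ennreal_of_nat_eq_real_of_nat)
    also have "\<dots> \<le> ennreal (exp (D (\<rho> / 4) + D (\<rho> / 16)) * exp (- 41 / 768 * (n * \<rho>\<^sup>2)))"
      using cN by (intro ennreal_leI mult_right_mono) auto
    finally show "(\<integral>\<^sup>+x. indicator F x * L t x \<partial>PP)
        \<le> ennreal (exp (D (\<rho> / 4) + D (\<rho> / 16) - 41 / 768 * (n * \<rho>\<^sup>2)))"
      by (simp add: exp_add[symmetric])
  next
    fix t assume t: "t \<in> S" "\<rho> / 2 < h s t" "h s t \<le> \<rho>"
    obtain v where v: "v \<in> N0" "h t v \<le> \<rho> / 16" using N0(4)[of t] t s by auto
    have "h s t \<le> h s v + h v t" using triangle[of s v t] v N0 s t by auto
    then have vN: "v \<in> N" using v t commute[of v t] by (simp add: N_def)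
    have "(\<integral>\<^sup>+x. indicator (space PP - F) x * L t x \<partial>PP)
        \<le> (\<integral>\<^sup>+x. indicator (space PP - rejects s v) x * L t x \<partial>PP)"
      using vN by (intro nn_integral_mono mult_right_mono) (auto simp: F_def split: split_indicator)
    also have "\<dots> \<le> ennreal (exp (- 41 / 768 * (n * \<rho>\<^sup>2)))"
      using vN N s t bound[OF sqv[OF vN] sqt[OF v(2)]]
      by (intro order_trans[OF test_error(2)] ennreal_leI) auto
    finally show "(\<integral>\<^sup>+x. indicator (space PP - F) x * L t x \<partial>PP) \<le> ennreal (exp (- 41 / 768 * (n * \<rho>\<^sup>2)))" .
  qed
qed

end

section \<open>Concentration of the posterior distribution\<close>

context bayes_model
begin

lemma h_measurable:
  assumes u: "u \<in> S" and M: "sets M = sets (hborel \<mu> f S)"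
  shows "h u \<in> borel_measurable M"
proof (rule borel_measurableI_le)
  interpret Metric_space S h by (rule metric_h)
  fix y
  have "closedin mtopology (mcball u y)" by (rule closedin_mcball)
  then have "openin mtopology (S - mcball u y)" by (simp add: closedin_def)
  moreover have "{U. openin mtopology U} \<subseteq> Pow S" using openin_subset by fastforce
  ultimately have "S - mcball u y \<in> sets (hborel \<mu> f S)"
    unfolding hborel_def by (subst sets_measure_of) (auto intro: sigma_sets.Basic)
  then have "S - (S - mcball u y) \<in> sets (hborel \<mu> f S)"
    using sets.compl_sets space_hborel by metis
  moreover have "S - (S - mcball u y) = {t \<in> space M. h u t \<le> y}"
    unfolding sets_eq_imp_space_eq[OF M] space_hborel mcball_def using u by blast
  ultimately show "{t \<in> space M. h u t \<le> y} \<in> sets M" by (simp add: M)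
qed

lemma hball_eq: "u \<in> S \<Longrightarrow> hball \<mu> f S u r = {t \<in> S. h u t \<le> r}"
  using Metric_space.mcball_def[OF metric_h] by auto

end

context sampled_model
begin

text \<open>The posterior is defined from densities with respect to \<open>\<mu>\<close>. Passing to densities with respect to \<open>P\<close>
multiplies the likelihood by a factor that does not depend on \<open>t\<close>, hence leaves the posterior unchanged.\<close>
lemma AE_likelihood_scaled: "AE x in PP. \<exists>c>0. \<forall>t\<in>S. likelihood f n t x = ennreal c * L t x"
proof -
  note [measurable] = p_measurable
  have "AE x in P. 0 < p x"
    unfolding P_eq by (subst AE_density) (auto simp: ennreal_less_zero_iff)
  then have "AE x in PP. \<forall>i\<in>{..<n}. 0 < p (x i)"
    by (intro AE_finite_allI AE_PP_component) auto
  then show ?thesis using AE_space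
  proof eventually_elim
    case (elim x)
    have "likelihood f n t x = ennreal (\<Prod>i<n. p (x i)) * L t x" if t: "t \<in> S" for t
    proof -
      have "ennreal (f t (x i)) = ennreal (p (x i)) * ennreal (g t (x i))" if i: "i < n" for i
      proof -
        have "x i \<in> space \<mu>" using elim(2) i by (auto simp: space_PiM space_P)
        moreover have "0 < p (x i)" using elim(1) i by simp
        ultimately show ?thesis using density_nonneg[OF t]
          by (simp add: g_def ennreal_mult[symmetric])
      qed
      moreover have "ennreal (\<Prod>i<n. p (x i)) = (\<Prod>i<n. ennreal (p (x i)))"
        using elim(1) by (intro prod_ennreal[symmetric]) (auto intro: less_imp_le)
      ultimately show ?thesis by (simp add: likelihood_def prod.distrib)
    qed
    moreover have "0 < (\<Prod>i<n. p (x i))" using elim(1) by (intro prod_pos) auto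
    ultimately show ?case by blast
  qed
qed

lemma L_measurable2: "x \<in> space PP \<Longrightarrow> (\<lambda>t. L t x) \<in> borel_measurable \<nu>"
  using measurable_Pair1[OF L_measurable] by simp

lemma AE_evidence_finite: "AE x in PP. (\<integral>\<^sup>+t. L t x \<partial>\<nu>) < \<infinity>"
proof -
  interpret nu: prob_space \<nu> by (rule prob_prior)
  have eq: "(\<integral>\<^sup>+t\<in>S. L t x \<partial>\<nu>) = (\<integral>\<^sup>+t. L t x \<partial>\<nu>)" for x
    by (intro nn_integral_cong) (simp add: space_prior)
  have S: "S \<in> sets \<nu>" using sets.top[of \<nu>] by (simp add: space_prior)
  note m = prior_integral_L_measurable[OF S, unfolded eq]
  have "(\<integral>\<^sup>+x. (\<integral>\<^sup>+t. L t x \<partial>\<nu>) \<partial>PP) = (\<integral>\<^sup>+t\<in>S. (\<integral>\<^sup>+x. L t x \<partial>PP) \<partial>\<nu>)"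
    using prior_integral_swap(1)[OF S, of "\<lambda>_. 1"] by (simp add: eq)
  also have "\<dots> \<le> (\<integral>\<^sup>+t. 1 \<partial>\<nu>)"
    by (intro nn_integral_mono) (auto simp: L_mass_le_1 split: split_indicator)
  finally have "(\<integral>\<^sup>+x. (\<integral>\<^sup>+t. L t x \<partial>\<nu>) \<partial>PP) \<noteq> \<infinity>"
    using nu.emeasure_space_1 by (auto simp: top_unique)
  from nn_integral_PInf_AE[OF m this] show ?thesis by (simp add: less_top)
qed

text \<open>The total evidence is at least the evidence of \<open>B\<close>. Multiplied by the latter, a posterior mass is therefore
bounded by an integral of the likelihood, in which the random denominator has disappeared. A sample at which
the evidence of \<open>B\<close> vanishes has no weight under the mixture over \<open>B\<close> and can be ignored.\<close>
lemma posterior_mass: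
  assumes x: "x \<in> space PP" and c: "0 < c" "\<forall>t\<in>S. likelihood f n t x = ennreal c * L t x"
    and fin: "(\<integral>\<^sup>+t. L t x \<partial>\<nu>) < \<infinity>"
    and [measurable]: "B \<in> sets \<nu>" and pos: "(\<integral>\<^sup>+t\<in>B. L t x \<partial>\<nu>) \<noteq> 0"
  shows "prob_space (posterior f \<nu> n x)"
    and "A \<in> sets \<nu> \<Longrightarrow>
      emeasure (posterior f \<nu> n x) A * (\<integral>\<^sup>+t\<in>B. L t x \<partial>\<nu>) \<le> (\<integral>\<^sup>+t\<in>A. L t x \<partial>\<nu>)"
proof -
  note [measurable] = L_measurable2[OF x]
  define E where "E = (\<integral>\<^sup>+t. L t x \<partial>\<nu>)"
  have QE: "(\<integral>\<^sup>+t\<in>B. L t x \<partial>\<nu>) \<le> E"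
    unfolding E_def by (intro nn_integral_mono) (auto split: split_indicator)
  then have E: "0 < E" "E < \<infinity>" using pos fin by (auto simp: E_def[symmetric] zero_less_iff_neq_zero)
  have Z: "(\<integral>\<^sup>+t. likelihood f n t x \<partial>\<nu>) = ennreal c * E"
    unfolding E_def using c(2)
    by (subst nn_integral_cmult[symmetric]) (auto intro!: nn_integral_cong simp: space_prior)
  have cancel: "ennreal c * a / (ennreal c * E) = a / E" for a
    using divide_mult_eq[of "ennreal c" a E] c(1) by (simp add: mult.commute)
  have lik: "likelihood f n t x / (ennreal c * E) = L t x / E" if "t \<in> space \<nu>" for t
    using bspec[OF c(2), of t] that by (simp only: space_prior cancel)
  have post: "posterior f \<nu> n x = density \<nu> (\<lambda>t. L t x / E)"
    unfolding posterior_def Z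
  proof (rule density_cong)
    show "(\<lambda>t. likelihood f n t x / (ennreal c * E)) \<in> borel_measurable \<nu>"
      by (subst measurable_cong[OF lik]) auto
  qed (use lik in auto)
  have mass: "emeasure (posterior f \<nu> n x) A = (\<integral>\<^sup>+t\<in>A. L t x \<partial>\<nu>) / E" if [measurable]: "A \<in> sets \<nu>" for A
  proof -
    have "emeasure (posterior f \<nu> n x) A = (\<integral>\<^sup>+t. L t x * indicator A t / E \<partial>\<nu>)"
      unfolding post by (subst emeasure_density) (simp_all add: divide_ennreal_def ac_simps)
    also have "\<dots> = (\<integral>\<^sup>+t\<in>A. L t x \<partial>\<nu>) / E" by (rule nn_integral_divide) measurable
    finally show ?thesis .
  qed
  show "prob_space (posterior f \<nu> n x)"
  proof
    have "emeasure (posterior f \<nu> n x) (space \<nu>) = E / E"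
    proof (subst mass)
      have "(\<integral>\<^sup>+t\<in>space \<nu>. L t x \<partial>\<nu>) = E" unfolding E_def by (intro nn_integral_cong) simp
      then show "(\<integral>\<^sup>+t\<in>space \<nu>. L t x \<partial>\<nu>) / E = E / E" by simp
    qed simp
    then show "emeasure (posterior f \<nu> n x) (space (posterior f \<nu> n x)) = 1"
      using E by (simp add: posterior_def ennreal_divide_self)
  qed
  show "emeasure (posterior f \<nu> n x) A * (\<integral>\<^sup>+t\<in>B. L t x \<partial>\<nu>) \<le> (\<integral>\<^sup>+t\<in>A. L t x \<partial>\<nu>)"
    if "A \<in> sets \<nu>"
  proof -
    have "emeasure (posterior f \<nu> n x) A * (\<integral>\<^sup>+t\<in>B. L t x \<partial>\<nu>)
      \<le> (\<integral>\<^sup>+t\<in>A. L t x \<partial>\<nu>) / E * E"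
      unfolding mass[OF that] using QE by (rule mult_left_mono) simp
    also have "\<dots> = (\<integral>\<^sup>+t\<in>A. L t x \<partial>\<nu>)"
      using E by (simp add: ennreal_divide_times mult_divide_eq_ennreal)
    finally show ?thesis .
  qed
qed

end

lemma dyadic_shell:
  fixes d :: real
  assumes "1 / 2 ^ j < d" "d \<le> 1"
  shows "\<exists>i<j. 1 / 2 ^ i / 2 < d \<and> d \<le> 1 / 2 ^ i"
  using assms
proof (induction j)
  case (Suc j)
  show ?case
  proof (cases "1 / 2 ^ j < d")
    case True
    then show ?thesis using Suc less_Suc_eq by blast
  next
    case False
    then show ?thesis using Suc.prems by (intro exI[of _ j]) (auto simp: field_simps)
  qed
qed simp

lemma sum_dyadic_le:
  assumes "j \<le> J"
  shows "(\<Sum>i<j. 1 / 2 ^ (J - i)) \<le> (1 / 2 ^ (J - j) :: real)"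
  using assms
proof (induction j)
  case (Suc j)
  have "(2::real) ^ (J - j) = 2 * 2 ^ (J - Suc j)"
    using Suc.prems by (metis Suc_diff_Suc Suc_le_lessD power_Suc)
  then show ?case using Suc by simp
qed simp

text \<open>The hypotheses of the theorem in the form in which they are used. Only shells with \<open>i + 6 \<le> J\<close> are tested:
the finer of the two nets has scale \<open>2\<^sup>-\<^sup>i / 16\<close>, and the entropy is controlled at scales down to
\<open>2 / 2\<^sup>J\<close>. The constant \<open>3 / 256\<close> is \<open>3 / 4 * 4\<^sup>-\<^sup>3\<close>, from \<open>\<gamma> \<le> 4\<close> and the bound for
\<open>\<gamma>\<^sup>3 * \<beta> J\<close>; it is smaller than the exponent \<open>41 / 768\<close> of the tests, so the tests win over the
prior mass of the shells.\<close>
locale bayes_experiment = sampled_model \<mu> S f \<nu> P p n + growing_loss w \<delta> a b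
  for \<mu> :: "'x measure" and S :: "'s set" and f \<nu> P p n w \<delta> a b +
  fixes s :: 's and D :: "real \<Rightarrow> real" and J :: nat and est :: "(nat \<Rightarrow> 'x) \<Rightarrow> 's"
  assumes s: "s \<in> S"
    and cov: "\<And>x t N. x \<in> {0<..1/4} \<Longrightarrow> t \<in> S \<Longrightarrow> N \<subseteq> hball \<mu> f S t (4 * x) \<Longrightarrow>
      separated h x N \<Longrightarrow> finite N \<and> real (card N) \<le> exp (D x)"
    and entropy: "\<And>i. i + 6 \<le> J \<Longrightarrow> D (1 / 2 ^ i / 4) + D (1 / 2 ^ i / 16) \<le> n / 4 ^ J / 2"
    and prior_growth: "\<And>i. i + 6 \<le> J \<Longrightarrow> measure \<nu> (hball \<mu> f S s (1 / 2 ^ i))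
      \<le> exp (3 / 256 * (n / 4 ^ i)) * measure \<nu> (hball \<mu> f S s (1 / 2 ^ J))"
    and prior_pos: "0 < measure \<nu> (hball \<mu> f S s (1 / 2 ^ J))"
    and n_large: "4 * 4 ^ J \<le> real n"
    and b_le: "b \<le> n / 4 ^ J / 16"
    and w_meas: "w \<in> borel_measurable (restrict_space borel {0..1})"
    and bayes: "bayes_estimator \<mu> S f \<nu> w P n est"
begin

definition \<Delta> :: real where "\<Delta> = 4 * ((5 / 4 * (1 + a / 2)) powr (1 / \<delta>) + 1)"
text \<open>Every exponent attached to shell \<open>i\<close>, at distance about \<open>2\<^sup>-\<^sup>i\<close> from \<open>s\<close>, is a multiple of this
number.\<close>
definition rate :: "nat \<Rightarrow> real" where "rate i = n / 4 ^ i"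
definition shell :: "nat \<Rightarrow> 's set" where "shell i = {t \<in> S. 1 / 2 ^ i / 2 < h s t \<and> h s t \<le> 1 / 2 ^ i}"
definition core :: "'s set" where "core = hball \<mu> f S s (1 / 2 ^ J)"
definition j0 :: nat where "j0 = J - 5"

lemma \<Delta>_ge: "8 \<le> \<Delta>"
  using ge_one_powr_ge_zero[of "5 / 4 * (1 + a / 2)" "1 / \<delta>"] a_pos \<delta>_pos by (simp add: \<Delta>_def)

lemma core_sets [measurable]: "core \<in> sets \<nu>" and shell_sets [measurable]: "shell i \<in> sets \<nu>"
proof -
  note [measurable] = h_measurable[OF s sets_prior]
  have "core = {t \<in> space \<nu>. h s t \<le> 1 / 2 ^ J}"
    by (simp add: core_def hball_eq s space_prior)
  then show "core \<in> sets \<nu>" by simp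
  have "shell i = {t \<in> space \<nu>. 1 / 2 ^ i / 2 < h s t \<and> h s t \<le> 1 / 2 ^ i}"
    by (simp add: shell_def space_prior)
  then show "shell i \<in> sets \<nu>" by simp
qed

lemma rate_ge: "i + 6 \<le> J \<Longrightarrow> 2048 * real (J - i) \<le> rate i"
proof -
  assume i: "i + 6 \<le> J"
  have *: "2048 * real k \<le> 4 * 4 ^ k" if "6 \<le> k" for k
    using that by (induction k rule: dec_induct) auto
  have "4 ^ J = (4::real) ^ (J - i) * 4 ^ i" using i by (simp flip: power_add)
  then have "4 * 4 ^ (J - i) \<le> rate i" using n_large by (simp add: rate_def pos_le_divide_eq)
  then show ?thesis using *[of "J - i"] i by linarith
qed

lemma two_power_le: "i + 6 \<le> J \<Longrightarrow> 2 ^ (J - i) \<le> exp (rate i / 2048)"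
proof -
  assume "i + 6 \<le> J"
  have "(2::real) ^ (J - i) \<le> exp 1 ^ (J - i)"
    using exp_ge_add_one_self[of 1] by (intro power_mono) auto
  also have "\<dots> = exp (real (J - i))" by (simp flip: exp_of_nat_mult)
  also have "\<dots> \<le> exp (rate i / 2048)" using rate_ge[OF \<open>i + 6 \<le> J\<close>] by simp
  finally show ?thesis .
qed

lemma rate_J: "i + k \<le> J \<Longrightarrow> n / 4 ^ J \<le> rate i / 4 ^ k"
proof -
  assume i: "i + k \<le> J"
  have "(4::real) ^ i * 4 ^ k \<le> 4 ^ J" using i by (simp flip: power_add)
  then show ?thesis by (simp add: rate_def divide_left_mono)
qed

lemma shell_tests: "\<exists>F. \<forall>i<j0. F i \<in> sets PP \<and>
    (\<forall>t\<in>core. (\<integral>\<^sup>+x. indicator (F i) x * L t x \<partial>PP) \<le> ennreal (exp ((1 / 8192 - 41 / 768) * rate i))) \<and>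
    (\<forall>t\<in>shell i. (\<integral>\<^sup>+x. indicator (space PP - F i) x * L t x \<partial>PP) \<le> ennreal (exp (- 41 / 768 * rate i)))"
proof (rule choice, intro allI)
  fix i
  show "\<exists>F. i < j0 \<longrightarrow> F \<in> sets PP \<and>
    (\<forall>t\<in>core. (\<integral>\<^sup>+x. indicator F x * L t x \<partial>PP) \<le> ennreal (exp ((1 / 8192 - 41 / 768) * rate i))) \<and>
    (\<forall>t\<in>shell i. (\<integral>\<^sup>+x. indicator (space PP - F) x * L t x \<partial>PP) \<le> ennreal (exp (- 41 / 768 * rate i)))"
  proof (cases "i < j0")
    case True
    then have i: "i + 6 \<le> J" by (simp add: j0_def)
    have n\<rho>: "n * (1 / 2 ^ i)\<^sup>2 = rate i"
      by (simp add: rate_def power_divide power2_eq_square flip: power_mult_distrib)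
    have ent: "exp (D (1 / 2 ^ i / 4) + D (1 / 2 ^ i / 16) - 41 / 768 * (n * (1 / 2 ^ i)\<^sup>2))
      \<le> exp ((1 / 8192 - 41 / 768) * rate i)"
    proof -
      have "D (1 / 2 ^ i / 4) + D (1 / 2 ^ i / 16) \<le> rate i / 4 ^ 6 / 2"
      proof (rule order_trans[OF entropy[OF i]])
        show "real n / 4 ^ J / 2 \<le> rate i / 4 ^ 6 / 2"
          using rate_J[OF i] by (rule divide_right_mono) simp
      qed
      then show ?thesis unfolding n\<rho> exp_le_cancel_iff left_diff_distrib by simp
    qed
    have "(2::real) ^ (i + 6) \<le> 2 ^ J" using i by (intro power_increasing) auto
    then have core: "1 / 2 ^ J \<le> 1 / 2 ^ i / (64::real)" by (simp add: power_add field_simps)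
    obtain F where F: "F \<in> sets PP"
      "\<And>t. t \<in> S \<Longrightarrow> h s t \<le> 1 / 2 ^ i / 64 \<Longrightarrow> (\<integral>\<^sup>+x. indicator F x * L t x \<partial>PP)
        \<le> ennreal (exp (D (1 / 2 ^ i / 4) + D (1 / 2 ^ i / 16) - 41 / 768 * (n * (1 / 2 ^ i)\<^sup>2)))"
      "\<And>t. t \<in> S \<Longrightarrow> 1 / 2 ^ i / 2 < h s t \<Longrightarrow> h s t \<le> 1 / 2 ^ i \<Longrightarrow>
        (\<integral>\<^sup>+x. indicator (space PP - F) x * L t x \<partial>PP) \<le> ennreal (exp (- 41 / 768 * (n * (1 / 2 ^ i)\<^sup>2)))"
      by (rule shell_test[OF cov s, where \<rho>="1 / 2 ^ i"]) auto
    show ?thesis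
    proof (intro exI[of _ F] impI conjI ballI)
      fix t assume "t \<in> core"
      then have "t \<in> S" "h s t \<le> 1 / 2 ^ i / 64" using core by (auto simp: core_def hball_eq s)
      from F(2)[OF this] show "(\<integral>\<^sup>+x. indicator F x * L t x \<partial>PP) \<le> ennreal (exp ((1 / 8192 - 41 / 768) * rate i))"
        using ent by (rule order_trans[OF _ ennreal_leI])
    next
      fix t assume "t \<in> shell i"
      then show "(\<integral>\<^sup>+x. indicator (space PP - F) x * L t x \<partial>PP) \<le> ennreal (exp (- 41 / 768 * rate i))"
        using F(3)[of t] unfolding n\<rho> by (auto simp: shell_def)
    qed (rule F(1))
  qed simp
qed

text \<open>On shell \<open>i\<close> the exponential weight \<open>exp (4 * b * (h s t)\<^sup>2 * 4 ^ j)\<close> required by the loss is at most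
\<open>exp (rate i / 4096)\<close>, because \<open>b \<le> n / 4 ^ J / 16\<close> and \<open>j + 5 \<le> J\<close>. The thresholds \<open>1 / 2 ^ (J - i)\<close>
do not depend on \<open>j\<close> and sum to at most \<open>1 / 32\<close>. For \<open>j < 2\<close> the claim is trivial, as \<open>h \<le> 1\<close> and
\<open>\<Delta> \<ge> 8\<close>.\<close>
lemma est_near:
  assumes "prob_space \<pi>" and sets_\<pi>: "sets \<pi> = sets \<nu>"
    and e: "e \<in> S" and min: "(\<integral>t. w (h e t) \<partial>\<pi>) \<le> (\<integral>t. w (h s t) \<partial>\<pi>)"
    and j: "j \<le> j0" and small: "\<And>i. i < j \<Longrightarrow> ennreal (exp (rate i / 4096)) * emeasure \<pi> (shell i) \<le> ennreal (1 / 2 ^ (J - i))"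
  shows "h e s \<le> \<Delta> / 2 ^ j"
proof (cases "j < 2")
  case True
  then have "(2::real) ^ j \<le> 2 ^ 1" by (intro power_increasing) auto
  then have "1 \<le> \<Delta> / 2 ^ j" using \<Delta>_ge by (simp add: pos_le_divide_eq)
  then show ?thesis using h_le_1[OF e s] by linarith
next
  case False
  then have J: "j + 5 \<le> J" using j by (simp add: j0_def)
  interpret \<pi>: prob_space \<pi> by fact
  have sp: "space \<pi> = S" using sets_eq_imp_space_eq[OF sets_\<pi>] space_prior by simp
  have [measurable]: "shell i \<in> sets \<pi>" for i using shell_sets sets_\<pi> by simp
  have "h e s \<le> 4 * ((5 / 4 * (1 + a / 2)) powr (1 / \<delta>) + 1) * (1 / 2 ^ j)"
  proof (rule minimizer_near_concentration_point[OF metric_h h_le_1 w_meas \<open>prob_space \<pi>\<close> sp _ s e min])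
    show "h u \<in> borel_measurable \<pi>" if "u \<in> S" for u
      using that by (rule h_measurable) (simp add: sets_\<pi> sets_prior)
    have "(2::real) ^ 2 \<le> 2 ^ j" using False by (intro power_increasing) auto
    then show "1 / 2 ^ j \<le> (1 / 4 :: real)" by (simp add: divide_simps)
    have "(\<integral>\<^sup>+t. ennreal (if 1 / 2 ^ j < h s t then exp (4 * b * (h s t)\<^sup>2 / (1 / 2 ^ j)\<^sup>2) else 0) \<partial>\<pi>)
      \<le> (\<integral>\<^sup>+t. (\<Sum>i<j. ennreal (exp (rate i / 4096)) * indicator (shell i) t) \<partial>\<pi>)"
    proof (rule nn_integral_mono)
      fix t assume "t \<in> space \<pi>"
      then have t: "t \<in> S" by (simp add: sp)
      show "ennreal (if 1 / 2 ^ j < h s t then exp (4 * b * (h s t)\<^sup>2 / (1 / 2 ^ j)\<^sup>2) else 0)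
        \<le> (\<Sum>i<j. ennreal (exp (rate i / 4096)) * indicator (shell i) t)"
      proof (cases "1 / 2 ^ j < h s t")
        case True
        obtain i where i: "i < j" "1 / 2 ^ i / 2 < h s t" "h s t \<le> 1 / 2 ^ i"
          using dyadic_shell[OF True h_le_1[OF s t]] by blast
        then have sh: "t \<in> shell i" using t by (simp add: shell_def)
        have "(h s t)\<^sup>2 \<le> (1 / 2 ^ i)\<^sup>2" using i h_nonneg[OF s t] by (intro power_mono) auto
        then have hs: "(h s t)\<^sup>2 \<le> 1 / 4 ^ i"
          by (simp add: power_divide power2_eq_square flip: power_mult_distrib)
        have "4 * b * (h s t)\<^sup>2 / (1 / 2 ^ j)\<^sup>2 = 4 * b * (h s t)\<^sup>2 * 4 ^ j"
          by (simp add: power_divide power2_eq_square flip: power_mult_distrib)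
        also have "\<dots> \<le> 4 * (n / 4 ^ J / 16) * (1 / 4 ^ i) * 4 ^ j"
          using hs b_le b_pos by (intro mult_right_mono mult_mono) auto
        also have "\<dots> = rate i * (4 ^ j / 4 ^ J) / 4" by (simp add: rate_def)
        also have "\<dots> \<le> rate i * (1 / 4 ^ 5) / 4"
        proof -
          have "(4::real) ^ (j + 5) \<le> 4 ^ J" using J by (intro power_increasing) auto
          then have "(4::real) ^ j / 4 ^ J \<le> 1 / 4 ^ 5" by (simp add: power_add field_simps)
          then show ?thesis by (intro divide_right_mono mult_left_mono) (auto simp: rate_def)
        qed
        finally have "exp (4 * b * (h s t)\<^sup>2 / (1 / 2 ^ j)\<^sup>2) \<le> exp (rate i / 4096)" by simp
        then have "ennreal (exp (4 * b * (h s t)\<^sup>2 / (1 / 2 ^ j)\<^sup>2))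
            \<le> ennreal (exp (rate i / 4096)) * indicator (shell i) t"
          using sh by (simp add: ennreal_leI)
        also have "\<dots> \<le> (\<Sum>i<j. ennreal (exp (rate i / 4096)) * indicator (shell i) t)"
          using i by (intro member_le_sum) auto
        finally show ?thesis using True by simp
      qed simp
    qed
    also have "\<dots> = (\<Sum>i<j. ennreal (exp (rate i / 4096)) * emeasure \<pi> (shell i))"
      by (subst nn_integral_sum) (auto simp: nn_integral_cmult)
    also have "\<dots> \<le> (\<Sum>i<j. ennreal (1 / 2 ^ (J - i)))"
      using small by (intro sum_mono) auto
    also have "\<dots> = ennreal (\<Sum>i<j. 1 / 2 ^ (J - i))" by (rule sum_ennreal) simp
    also have "\<dots> \<le> ennreal (1 / 5)"
    proof (rule ennreal_leI)
      have "(2::real) ^ 5 \<le> 2 ^ (J - j)" using J by (intro power_increasing) auto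
      then have "1 / 2 ^ (J - j) \<le> (1 / 5 :: real)" by (simp add: divide_simps)
      moreover have "(\<Sum>i<j. 1 / 2 ^ (J - i)) \<le> (1 / 2 ^ (J - j) :: real)"
        using J by (intro sum_dyadic_le) simp
      ultimately show "(\<Sum>i<j. 1 / 2 ^ (J - i)) \<le> (1 / 5 :: real)" by (rule order_trans[rotated])
    qed
    finally show "(\<integral>\<^sup>+t. ennreal (if 1 / 2 ^ j < h s t then exp (4 * b * (h s t)\<^sup>2 / (1 / 2 ^ j)\<^sup>2) else 0) \<partial>\<pi>)
      \<le> ennreal (1 / 5)" .
  qed simp_all
  then show ?thesis by (simp add: \<Delta>_def)
qed

end

section \<open>The exponential moment of the loss\<close>

context bayes_experiment
begin

text \<open>The loss in the scale of the exponents. Subtracting the contribution of radii up to \<open>\<Delta> / 2 ^ j0\<close>, where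
nothing is claimed about the estimator, makes the exponential moment bounded by an absolute constant.\<close>
definition loss_exponent :: "(nat \<Rightarrow> 'x) \<Rightarrow> real" where
  "loss_exponent x = (n * (h (est x) s)\<^sup>2 / \<Delta>\<^sup>2 - rate j0) / 32"

lemma rate_nonneg: "0 \<le> rate i"
  by (simp add: rate_def)

lemma est_in: "x \<in> space PP \<Longrightarrow> est x \<in> S"
  using bayes unfolding bayes_estimator_def by (auto dest: measurable_space simp: space_hborel)

lemma hellinger_est_measurable: "(\<lambda>x. h (est x) s) \<in> borel_measurable PP"
proof -
  have "est \<in> PP \<rightarrow>\<^sub>M hborel \<mu> f S" using bayes by (simp add: bayes_estimator_def)
  from measurable_compose[OF this h_measurable[OF s refl]]
  show ?thesis using Metric_space.commute[OF metric_h] by simp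
qed

lemma loss_exponent_le:
  assumes "e \<in> S" "h e s \<le> \<Delta> / 2 ^ j"
  shows "n * (h e s)\<^sup>2 / \<Delta>\<^sup>2 \<le> rate j"
proof -
  have "(h e s)\<^sup>2 \<le> (\<Delta> / 2 ^ j)\<^sup>2" using assms h_nonneg[OF _ s] by (intro power_mono) auto
  also have "\<dots> = \<Delta>\<^sup>2 / 4 ^ j" by (simp add: power_divide power2_eq_square flip: power_mult_distrib)
  finally have "(h e s)\<^sup>2 / \<Delta>\<^sup>2 \<le> 1 / 4 ^ j" using \<Delta>_ge by (simp add: field_simps)
  then have "n * ((h e s)\<^sup>2 / \<Delta>\<^sup>2) \<le> n * (1 / 4 ^ j)" by (rule mult_left_mono) simp
  then show ?thesis by (simp add: rate_def)
qed

text \<open>The marginal likelihood of a set of parameters. The evidence of \<open>core\<close> is, up to the factor \<open>\<nu> core\<close>, the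
density of the mixture law of the sample under which all error probabilities are computed.\<close>
definition evidence :: "'s set \<Rightarrow> (nat \<Rightarrow> 'x) \<Rightarrow> ennreal" where
  "evidence A x = (\<integral>\<^sup>+t\<in>A. L t x \<partial>\<nu>)"

text \<open>The two ways in which shell \<open>i\<close> can spoil the estimator: its test rejects, or it accepts and the shell has
posterior mass above the threshold \<open>exp (- rate i / 4096) / 2 ^ (J - i)\<close> (in the form given by Markov's
inequality).\<close>
definition shell_cost :: "(nat \<Rightarrow> (nat \<Rightarrow> 'x) set) \<Rightarrow> nat \<Rightarrow> (nat \<Rightarrow> 'x) \<Rightarrow> ennreal" where
  "shell_cost F i x = indicator (F i) x * evidence core x
     + ennreal (2 ^ (J - i) * exp (rate i / 4096)) * (indicator (space PP - F i) x * evidence (shell i) x)"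

text \<open>Let \<open>i\<close> be the first bad shell. All shells before it are good, so the estimator is within \<open>\<Delta> / 2 ^ i\<close> of
\<open>s\<close> and the loss exponent is at most \<open>rate i / 32\<close>; the weight of the sample is paid for by the cost of shell
\<open>i\<close>. If there is no bad shell, the loss exponent is not positive.\<close>
lemma exp_loss_le:
  "AE x in PP. ennreal (exp (loss_exponent x)) * evidence core x
     \<le> evidence core x + (\<Sum>i<j0. ennreal (exp (rate i / 32)) * shell_cost F i x)"
proof -
  have "AE x in PP. is_arg_min (posterior_risk \<mu> f \<nu> w n x) (\<lambda>u. u \<in> S) (est x)"
    using bayes by (simp add: bayes_estimator_def)
  with AE_likelihood_scaled AE_evidence_finite AE_space show ?thesis
  proof eventually_elim
    case (elim x)
    show ?case
    proof (cases "evidence core x = 0")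
      case False
      define \<pi> where "\<pi> = posterior f \<nu> n x"
      obtain c where c: "0 < c" "\<forall>t\<in>S. likelihood f n t x = ennreal c * L t x"
        using elim(1) by blast
      note post = posterior_mass[OF elim(3) c elim(2) core_sets False[unfolded evidence_def], folded \<pi>_def evidence_def]
      have sets_\<pi>: "sets \<pi> = sets \<nu>" by (simp add: \<pi>_def posterior_def)
      have min: "(\<integral>t. w (h (est x) t) \<partial>\<pi>) \<le> (\<integral>t. w (h s t) \<partial>\<pi>)"
        using elim(4) s unfolding is_arg_min_def posterior_risk_def \<pi>_def[symmetric]
        by (auto simp: not_less)
      note near = est_near[OF post(1) sets_\<pi> est_in[OF elim(3)] min]
      define bad where "bad i \<longleftrightarrow> x \<in> F i \<or>
        ennreal (1 / 2 ^ (J - i)) < ennreal (exp (rate i / 4096)) * emeasure \<pi> (shell i)" for i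
      show ?thesis
      proof (cases "\<exists>i<j0. bad i")
        case False
        have "ennreal (exp (rate k / 4096)) * emeasure \<pi> (shell k) \<le> ennreal (1 / 2 ^ (J - k))"
          if "k < j0" for k
          using False that unfolding bad_def by (meson not_less)
        then have "h (est x) s \<le> \<Delta> / 2 ^ j0" by (rule near[OF order_refl])
        then have "loss_exponent x \<le> 0"
          using loss_exponent_le[OF est_in[OF elim(3)]] by (simp add: loss_exponent_def)
        then have "ennreal (exp (loss_exponent x)) \<le> 1"
          by (simp add: ennreal_le_1)
        then have "ennreal (exp (loss_exponent x)) * evidence core x \<le> 1 * evidence core x"
          by (rule mult_right_mono) simp
        then show ?thesis by (simp add: add_increasing2)
      next
        case True
        define i where "i = (LEAST i. i < j0 \<and> bad i)"
        have i: "i < j0" "bad i" using LeastI_ex[OF True] by (auto simp: i_def)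
        have first: "\<not> bad k" if "k < i" for k
          using not_less_Least[of k "\<lambda>i. i < j0 \<and> bad i"] that i(1) by (auto simp: i_def)
        have "ennreal (exp (rate k / 4096)) * emeasure \<pi> (shell k) \<le> ennreal (1 / 2 ^ (J - k))"
          if "k < i" for k
          using first[OF that] unfolding bad_def by (meson not_less)
        then have "h (est x) s \<le> \<Delta> / 2 ^ i" by (rule near[OF less_imp_le[OF i(1)]])
        from loss_exponent_le[OF est_in[OF elim(3)] this]
        have "n * (h (est x) s)\<^sup>2 / \<Delta>\<^sup>2 - rate j0 \<le> rate i"
          using rate_nonneg[of j0] by (simp add: diff_le_eq add_increasing2)
        then have "loss_exponent x \<le> rate i / 32"
          unfolding loss_exponent_def by (rule divide_right_mono) simp
        then have le: "ennreal (exp (loss_exponent x)) \<le> ennreal (exp (rate i / 32))"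
          by (intro ennreal_leI) simp
        have cost: "evidence core x \<le> shell_cost F i x"
        proof (cases "x \<in> F i")
          case True
          then show ?thesis by (simp add: shell_cost_def)
        next
          case False
          have "ennreal 1 = ennreal (2 ^ (J - i)) * ennreal (1 / 2 ^ (J - i))"
            by (simp add: ennreal_mult[symmetric])
          also have "\<dots> \<le> ennreal (2 ^ (J - i)) * (ennreal (exp (rate i / 4096)) * emeasure \<pi> (shell i))"
            using i(2) False by (intro mult_left_mono) (auto simp: bad_def)
          also have "\<dots> = ennreal (2 ^ (J - i) * exp (rate i / 4096)) * emeasure \<pi> (shell i)"
            by (simp add: ennreal_mult mult.assoc)
          finally have "1 * evidence core x \<le> ennreal (2 ^ (J - i) * exp (rate i / 4096)) * emeasure \<pi> (shell i) * evidence core x"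
            by (intro mult_right_mono) auto
          also have "\<dots> \<le> ennreal (2 ^ (J - i) * exp (rate i / 4096)) * evidence (shell i) x"
            using post(2)[OF shell_sets, of i] by (simp add: mult.assoc mult_left_mono)
          finally show ?thesis using False elim(3) by (simp add: shell_cost_def)
        qed
        have "ennreal (exp (loss_exponent x)) * evidence core x \<le> ennreal (exp (rate i / 32)) * shell_cost F i x"
          by (rule mult_mono[OF le cost]) auto
        also have "\<dots> \<le> (\<Sum>i<j0. ennreal (exp (rate i / 32)) * shell_cost F i x)"
          using i by (intro member_le_sum) auto
        finally show ?thesis by (simp add: add_increasing)
      qed
    qed simp
  qed
qed

lemma evidence_measurable [measurable]: "A \<in> sets \<nu> \<Longrightarrow> evidence A \<in> borel_measurable PP"
  unfolding evidence_def by (rule prior_integral_L_measurable)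

lemma weighted_evidence_le:
  assumes A: "A \<in> sets \<nu>" and F: "G \<in> sets PP"
    and bound: "\<And>t. t \<in> A \<Longrightarrow> (\<integral>\<^sup>+x. indicator G x * L t x \<partial>PP) \<le> ennreal c"
  shows "(\<integral>\<^sup>+x. indicator G x * evidence A x \<partial>PP) \<le> ennreal c * emeasure \<nu> A"
proof -
  have "(\<integral>\<^sup>+x. indicator G x * evidence A x \<partial>PP) = (\<integral>\<^sup>+t\<in>A. (\<integral>\<^sup>+x. indicator G x * L t x \<partial>PP) \<partial>\<nu>)"
    unfolding evidence_def using A F by (intro prior_integral_swap) auto
  also have "\<dots> \<le> (\<integral>\<^sup>+t\<in>A. ennreal c \<partial>\<nu>)"
    using bound by (intro nn_integral_mono) (auto split: split_indicator)
  finally show ?thesis using A by (simp add: nn_integral_cmult_indicator)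
qed

text \<open>The exponents \<open>1 / 32\<close>, \<open>1 / 8192\<close> or \<open>1 / 2048 + 1 / 4096\<close>, and \<open>3 / 256\<close> add up to less than
\<open>41 / 768 - 1 / 128\<close>, and \<open>exp (- rate i / 128)\<close> is at most \<open>1 / 2 ^ (J - i)\<close>.\<close>
lemma shell_cost_integral:
  assumes i: "i < j0" and F: "F i \<in> sets PP"
    and first: "\<And>t. t \<in> core \<Longrightarrow> (\<integral>\<^sup>+x. indicator (F i) x * L t x \<partial>PP) \<le> ennreal (exp ((1 / 8192 - 41 / 768) * rate i))"
    and second: "\<And>t. t \<in> shell i \<Longrightarrow> (\<integral>\<^sup>+x. indicator (space PP - F i) x * L t x \<partial>PP) \<le> ennreal (exp (- 41 / 768 * rate i))"
  shows "(\<integral>\<^sup>+x. ennreal (exp (rate i / 32)) * shell_cost F i x \<partial>PP) \<le> ennreal (2 / 2 ^ (J - i)) * emeasure \<nu> core"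
proof -
  have iJ: "i + 6 \<le> J" using i by (simp add: j0_def)
  interpret nu: prob_space \<nu> by (rule prob_prior)
  define m where "m = measure \<nu> core"
  have m: "0 \<le> m" "emeasure \<nu> core = ennreal m" by (simp_all add: m_def nu.emeasure_eq_measure)
  have "shell i \<subseteq> hball \<mu> f S s (1 / 2 ^ i)" by (auto simp: shell_def hball_eq s)
  moreover have "hball \<mu> f S s (1 / 2 ^ i) \<in> sets \<nu>"
  proof -
    note [measurable] = h_measurable[OF s sets_prior]
    have "hball \<mu> f S s (1 / 2 ^ i) = {t \<in> space \<nu>. h s t \<le> 1 / 2 ^ i}"
      by (simp add: hball_eq s space_prior)
    then show ?thesis by simp
  qed
  ultimately have "measure \<nu> (shell i) \<le> measure \<nu> (hball \<mu> f S s (1 / 2 ^ i))"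
    by (rule nu.finite_measure_mono)
  also have "\<dots> \<le> exp (3 / 256 * rate i) * m"
    using prior_growth[OF iJ] by (simp add: rate_def m_def core_def)
  finally have shell_mass: "emeasure \<nu> (shell i) \<le> ennreal (exp (3 / 256 * rate i) * m)"
    by (simp add: nu.emeasure_eq_measure ennreal_leI)
  have A: "(\<integral>\<^sup>+x. indicator (F i) x * evidence core x \<partial>PP) \<le> ennreal (exp ((1 / 8192 - 41 / 768) * rate i) * m)"
    using weighted_evidence_le[OF core_sets F first] m by (simp add: ennreal_mult)
  have "(\<integral>\<^sup>+x. indicator (space PP - F i) x * evidence (shell i) x \<partial>PP) \<le> ennreal (exp (- 41 / 768 * rate i)) * emeasure \<nu> (shell i)"
    using F second by (intro weighted_evidence_le) auto
  also have "\<dots> \<le> ennreal (exp (- 41 / 768 * rate i)) * ennreal (exp (3 / 256 * rate i) * m)"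
    using shell_mass by (rule mult_left_mono) simp
  also have "\<dots> = ennreal (exp (- 32 / 768 * rate i) * m)"
    by (simp add: ennreal_mult[symmetric] m mult.assoc[symmetric] flip: exp_add)
  finally have B: "(\<integral>\<^sup>+x. indicator (space PP - F i) x * evidence (shell i) x \<partial>PP) \<le> ennreal (exp (- 32 / 768 * rate i) * m)" .
  note rate_nn = rate_nonneg[of i]
  have small: "exp (- (rate i / 128)) \<le> 1 / 2 ^ (J - i)"
  proof -
    have "2 ^ (J - i) \<le> exp (rate i / 2048)" by (rule two_power_le[OF iJ])
    also have "\<dots> \<le> exp (rate i / 128)" using rate_nn by simp
    finally show ?thesis by (simp add: exp_minus field_simps)
  qed
  have "(\<integral>\<^sup>+x. ennreal (exp (rate i / 32)) * shell_cost F i x \<partial>PP)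
    = ennreal (exp (rate i / 32)) * ((\<integral>\<^sup>+x. indicator (F i) x * evidence core x \<partial>PP)
      + ennreal (2 ^ (J - i) * exp (rate i / 4096)) * (\<integral>\<^sup>+x. indicator (space PP - F i) x * evidence (shell i) x \<partial>PP))"
    unfolding shell_cost_def using F by (simp add: nn_integral_add nn_integral_cmult)
  also have "\<dots> \<le> ennreal (exp (rate i / 32)) * (ennreal (exp ((1 / 8192 - 41 / 768) * rate i) * m)
      + ennreal (2 ^ (J - i) * exp (rate i / 4096)) * ennreal (exp (- 32 / 768 * rate i) * m))"
    by (intro mult_left_mono add_mono A B) auto
  also have "\<dots> = ennreal (exp (rate i / 32) * (exp ((1 / 8192 - 41 / 768) * rate i) * m
      + 2 ^ (J - i) * exp (rate i / 4096) * (exp (- 32 / 768 * rate i) * m)))"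
    using m(1) by (simp add: ennreal_mult[symmetric] ennreal_plus[symmetric] del: ennreal_plus)
  also have "\<dots> \<le> ennreal (2 / 2 ^ (J - i) * m)"
  proof (rule ennreal_leI)
    have "exp (rate i / 32) * (exp ((1 / 8192 - 41 / 768) * rate i) * m
        + 2 ^ (J - i) * exp (rate i / 4096) * (exp (- 32 / 768 * rate i) * m))
      = (exp (rate i / 32) * exp ((1 / 8192 - 41 / 768) * rate i)
        + 2 ^ (J - i) * (exp (rate i / 32) * exp (rate i / 4096) * exp (- 32 / 768 * rate i))) * m"
      by (simp add: algebra_simps)
    also have "\<dots> \<le> (exp (- (rate i / 128)) + exp (- (rate i / 128))) * m"
    proof (intro mult_right_mono add_mono m(1))
      show "exp (rate i / 32) * exp ((1 / 8192 - 41 / 768) * rate i) \<le> exp (- (rate i / 128))"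
        using rate_nn by (simp flip: exp_add)
      have "2 ^ (J - i) * (exp (rate i / 32) * exp (rate i / 4096) * exp (- 32 / 768 * rate i))
        \<le> exp (rate i / 2048) * (exp (rate i / 32) * exp (rate i / 4096) * exp (- 32 / 768 * rate i))"
        using two_power_le[OF iJ] by (intro mult_right_mono) auto
      also have "\<dots> \<le> exp (- (rate i / 128))"
        using rate_nn by (simp flip: exp_add) 
      finally show "2 ^ (J - i) * (exp (rate i / 32) * exp (rate i / 4096) * exp (- 32 / 768 * rate i))
        \<le> exp (- (rate i / 128))" .
    qed
    also have "\<dots> \<le> 2 / 2 ^ (J - i) * m"
      using small m(1) by (intro mult_right_mono) auto
    finally show "exp (rate i / 32) * (exp ((1 / 8192 - 41 / 768) * rate i) * m
        + 2 ^ (J - i) * exp (rate i / 4096) * (exp (- 32 / 768 * rate i) * m)) \<le> 2 / 2 ^ (J - i) * m" .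
  qed
  also have "\<dots> = ennreal (2 / 2 ^ (J - i)) * emeasure \<nu> core"
    unfolding m(2) using m(1) by (rule ennreal_mult'')
  finally show ?thesis .
qed

lemma exp_loss_integral:
  "(\<integral>\<^sup>+x. ennreal (exp (loss_exponent x)) * evidence core x \<partial>PP) \<le> ennreal (17 / 16) * emeasure \<nu> core"
proof -
  obtain F where F: "\<And>i. i < j0 \<Longrightarrow> F i \<in> sets PP"
    "\<And>i t. i < j0 \<Longrightarrow> t \<in> core \<Longrightarrow> (\<integral>\<^sup>+x. indicator (F i) x * L t x \<partial>PP) \<le> ennreal (exp ((1 / 8192 - 41 / 768) * rate i))"
    "\<And>i t. i < j0 \<Longrightarrow> t \<in> shell i \<Longrightarrow> (\<integral>\<^sup>+x. indicator (space PP - F i) x * L t x \<partial>PP) \<le> ennreal (exp (- 41 / 768 * rate i))"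
    using shell_tests by blast
  have "(\<integral>\<^sup>+x. ennreal (exp (loss_exponent x)) * evidence core x \<partial>PP)
    \<le> (\<integral>\<^sup>+x. evidence core x + (\<Sum>i<j0. ennreal (exp (rate i / 32)) * shell_cost F i x) \<partial>PP)"
    by (rule nn_integral_mono_AE) (rule exp_loss_le)
  also have "\<dots> = (\<integral>\<^sup>+x. evidence core x \<partial>PP)
      + (\<Sum>i<j0. \<integral>\<^sup>+x. ennreal (exp (rate i / 32)) * shell_cost F i x \<partial>PP)"
  proof -
    have sm: "shell_cost F i \<in> borel_measurable PP" if "i < j0" for i
    proof -
      note [measurable] = F(1)[OF that]
      show ?thesis unfolding shell_cost_def by measurable
    qed
    then have tm: "(\<lambda>x. ennreal (exp (rate i / 32)) * shell_cost F i x) \<in> borel_measurable PP"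
      if "i \<in> {..<j0}" for i
      using that by simp
    have "(\<integral>\<^sup>+x. evidence core x + (\<Sum>i<j0. ennreal (exp (rate i / 32)) * shell_cost F i x) \<partial>PP)
      = (\<integral>\<^sup>+x. evidence core x \<partial>PP) + (\<integral>\<^sup>+x. (\<Sum>i<j0. ennreal (exp (rate i / 32)) * shell_cost F i x) \<partial>PP)"
      by (intro nn_integral_add borel_measurable_sum tm evidence_measurable core_sets)
    also have "(\<integral>\<^sup>+x. (\<Sum>i<j0. ennreal (exp (rate i / 32)) * shell_cost F i x) \<partial>PP)
      = (\<Sum>i<j0. \<integral>\<^sup>+x. ennreal (exp (rate i / 32)) * shell_cost F i x \<partial>PP)"
      by (rule nn_integral_sum[OF tm])
    finally show ?thesis .
  qed
  also have "\<dots> \<le> ennreal 1 * emeasure \<nu> core + (\<Sum>i<j0. ennreal (2 / 2 ^ (J - i)) * emeasure \<nu> core)"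
  proof (intro add_mono sum_mono)
    have "(\<integral>\<^sup>+x. indicator (space PP) x * L t x \<partial>PP) \<le> ennreal 1" if "t \<in> core" for t
    proof -
      have "(\<integral>\<^sup>+x. indicator (space PP) x * L t x \<partial>PP) = (\<integral>\<^sup>+x. L t x \<partial>PP)"
        by (intro nn_integral_cong) auto
      then show ?thesis using L_mass_le_1[of t] that by (auto simp: core_def hball_eq s)
    qed
    then have "(\<integral>\<^sup>+x. indicator (space PP) x * evidence core x \<partial>PP) \<le> ennreal 1 * emeasure \<nu> core"
      by (intro weighted_evidence_le) auto
    moreover have "(\<integral>\<^sup>+x. indicator (space PP) x * evidence core x \<partial>PP) = (\<integral>\<^sup>+x. evidence core x \<partial>PP)"
      by (intro nn_integral_cong) auto
    ultimately show "(\<integral>\<^sup>+x. evidence core x \<partial>PP) \<le> ennreal 1 * emeasure \<nu> core" by simp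
  qed (use F in \<open>auto intro!: shell_cost_integral\<close>)
  also have "\<dots> = ennreal (1 + (\<Sum>i<j0. 2 / 2 ^ (J - i))) * emeasure \<nu> core"
  proof -
    have "ennreal (1 + (\<Sum>i<j0. 2 / 2 ^ (J - i))) = ennreal 1 + (\<Sum>i<j0. ennreal (2 / 2 ^ (J - i)))"
      by (simp add: sum_ennreal sum_nonneg)
    then show ?thesis by (simp only: distrib_right sum_distrib_right)
  qed
  also have "\<dots> \<le> ennreal (17 / 16) * emeasure \<nu> core"
  proof (intro mult_right_mono ennreal_leI)
    show "1 + (\<Sum>i<j0. 2 / 2 ^ (J - i)) \<le> (17 / 16 :: real)"
    proof (cases "j0 = 0")
      case False
      then have "J - j0 = 5" by (simp add: j0_def)
      then have "(\<Sum>i<j0. 1 / 2 ^ (J - i)) \<le> (1 / 2 ^ 5 :: real)"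
        using sum_dyadic_le[of j0 J] by (simp add: j0_def)
      moreover have "(\<Sum>i<j0. 2 / 2 ^ (J - i)) = 2 * (\<Sum>i<j0. 1 / 2 ^ (J - i) :: real)"
        by (simp add: sum_distrib_left)
      ultimately show ?thesis by simp
    qed simp
  qed simp
  finally show ?thesis .
qed

text \<open>The variational inequality for the mixture over \<open>core\<close> turns the bound on the exponential moment into a bound on
the risk under \<open>P\<close>; the divergence of \<open>P\<close> from the model costs the term \<open>n * K\<close>. Divided by
\<open>\<Delta>\<^sup>2\<close>, the risk is at most the sum of \<open>32 * K\<close> (the loss exponent carries a factor \<open>1 / 32\<close>),
of \<open>1 / 4 ^ j0 \<le> 1024 / 4 ^ J\<close> and of \<open>2 / n \<le> 1 / 4 ^ J\<close>.\<close>
lemma bayes_risk_bound: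
  assumes K: "0 \<le> K" and Kdef: "1 / emeasure \<nu> core * (\<integral>\<^sup>+t\<in>core. kullback P (model_dist \<mu> f t) \<partial>\<nu>) = ennreal K"
  shows "(\<integral>x. (h (est x) s)\<^sup>2 \<partial>PP) \<le> 1056 * \<Delta>\<^sup>2 * (1 / 4 ^ J + K)"
proof -
  interpret nu: prob_space \<nu> by (rule prob_prior)
  interpret PP: prob_space PP by (rule prob_space_PiM) (rule prob_P)
  define m where "m = measure \<nu> core"
  have m: "0 < m" "emeasure \<nu> core = ennreal m"
    using prior_pos by (simp_all add: m_def nu.emeasure_eq_measure core_def)
  have J4: "1 \<le> (4::real) ^ J" by simp
  have n: "0 < n" using n_large J4 by (cases "n = 0") auto
  have ih: "integrable PP (\<lambda>x. (h (est x) s)\<^sup>2)"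
  proof (rule PP.integrable_const_bound)
    show "AE x in PP. norm ((h (est x) s)\<^sup>2) \<le> 1"
      using h_le_1[OF est_in s] h_nonneg[OF est_in s] by (intro AE_I2) (simp add: power_le_one)
    show "(\<lambda>x. (h (est x) s)\<^sup>2) \<in> borel_measurable PP"
      using hellinger_est_measurable by measurable
  qed
  define E where "E = (\<integral>x. (h (est x) s)\<^sup>2 \<partial>PP)"
  have iY: "integrable PP loss_exponent"
    and Y: "(\<integral>x. loss_exponent x \<partial>PP) = (n * E / \<Delta>\<^sup>2 - rate j0) / 32"
    using ih by (simp_all add: loss_exponent_def[abs_def] E_def PP.prob_space)
  have kull: "(\<integral>\<^sup>+t\<in>core. kullback P (model_dist \<mu> f t) \<partial>\<nu>) = ennreal K * ennreal m"
  proof -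
    have "ennreal m * (1 / ennreal m) = 1"
      using m by (simp add: ennreal_times_divide ennreal_divide_self)
    then show ?thesis using Kdef[symmetric] unfolding m(2) by (simp add: ac_simps) (simp flip: mult.assoc)
  qed
  have "ennreal ((\<integral>x. loss_exponent x \<partial>PP) + 1) * ennreal m
    \<le> of_nat n * (ennreal K * ennreal m) + ennreal (17 / 16) * ennreal m"
    using averaged_kullback_variational[OF iY n core_sets, folded evidence_def] exp_loss_integral
    unfolding kull m(2) by (auto intro: order_trans add_left_mono)
  also have "\<dots> = ennreal (n * K + 17 / 16) * ennreal m"
    using K by (simp add: distrib_right ennreal_mult ennreal_of_nat_eq_real_of_nat mult.assoc)
  finally have "(\<integral>x. loss_exponent x \<partial>PP) + 1 \<le> n * K + 17 / 16"
  proof -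
    assume le: "ennreal ((\<integral>x. loss_exponent x \<partial>PP) + 1) * ennreal m \<le> ennreal (n * K + 17 / 16) * ennreal m"
    have "0 \<le> n * K + 17 / 16" using K by simp
    then have "((\<integral>x. loss_exponent x \<partial>PP) + 1) * m \<le> (n * K + 17 / 16) * m"
      using le m(1) by (simp add: ennreal_mult''[symmetric] ennreal_le_iff)
    then show ?thesis using m(1) by simp
  qed
  moreover define X where "X = n * E / \<Delta>\<^sup>2"
  ultimately have "X \<le> 32 * (n * K) + rate j0 + 2" unfolding Y X_def[symmetric]
    by (simp add: field_simps)
  then have *: "n * E / \<Delta>\<^sup>2 \<le> 32 * (n * K) + rate j0 + 2" by (simp add: X_def)
  have D2: "0 < \<Delta>\<^sup>2" using \<Delta>_ge by simp
  define q :: real where "q = 1 / 4 ^ J"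
  have q: "0 \<le> q" by (simp add: q_def)
  have "E / \<Delta>\<^sup>2 \<le> 32 * K + 1 / 4 ^ j0 + 2 / n"
    using * n by (simp add: rate_def field_simps)
  also have "1 / 4 ^ j0 \<le> 1024 * q"
  proof -
    have "(4::real) ^ J \<le> 4 ^ (j0 + 5)" by (intro power_increasing) (auto simp: j0_def)
    then show ?thesis by (simp add: q_def power_add field_simps)
  qed
  also have "2 / real n \<le> q"
  proof -
    have "2 * 4 ^ J \<le> real n" using n_large J4 by simp
    then show ?thesis using n by (simp add: q_def divide_simps)
  qed
  finally have "E / \<Delta>\<^sup>2 \<le> 1056 * (q + K)" using K q by simp
  then have "E \<le> 1056 * (q + K) * \<Delta>\<^sup>2" using D2 by (simp only: pos_divide_le_eq)
  then show ?thesis by (simp add: E_def q_def mult.commute mult.left_commute)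
qed

end

section \<open>The risk bound for Bayes estimators\<close>

lemma density_of_absolutely_continuous:
  assumes "bayes_model \<mu> S f \<nu>" "prob_space P" "sets P = sets \<mu>" "t \<in> S"
    and ac: "absolutely_continuous (model_dist \<mu> f t) P"
  obtains p where "p \<in> borel_measurable \<mu>" "\<And>x. x \<in> space \<mu> \<Longrightarrow> 0 \<le> p x"
    "P = density \<mu> (\<lambda>x. ennreal (p x))"
proof -
  interpret bayes_model \<mu> S f \<nu> by fact
  interpret P: prob_space P by fact
  interpret Pt: prob_space "model_dist \<mu> f t" using assms by (intro prob_model)
  have sm: "sets (model_dist \<mu> f t) = sets \<mu>" by (simp add: model_dist_def)
  have [measurable]: "f t \<in> borel_measurable \<mu>" 
    using prob_density_model[OF \<open>t \<in> S\<close>] by (simp add: prob_density_def)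
  obtain k where k: "k \<in> borel_measurable (model_dist \<mu> f t)"
    "AE x in model_dist \<mu> f t. RN_deriv (model_dist \<mu> f t) P x = ennreal (k x)" "\<And>x. 0 \<le> k x"
    using Pt.real_RN_deriv[OF P.finite_measure_axioms ac] assms(3) sm by metis
  have [measurable]: "k \<in> borel_measurable \<mu>"
    using k(1) measurable_cong_sets[OF sm refl] by blast
  have "P = density (model_dist \<mu> f t) (RN_deriv (model_dist \<mu> f t) P)"
    using Pt.density_RN_deriv[OF ac] assms(3) sm by simp
  also have "\<dots> = density (model_dist \<mu> f t) (\<lambda>x. ennreal (k x))"
    using k by (intro density_cong) auto
  also have "\<dots> = density \<mu> (\<lambda>x. ennreal (f t x) * ennreal (k x))"
    unfolding model_dist_def by (subst density_density_eq) auto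
  also have "\<dots> = density \<mu> (\<lambda>x. ennreal (f t x * k x))"
    using density_nonneg[OF \<open>t \<in> S\<close>] k(3) by (intro density_cong) (auto simp: ennreal_mult)
  finally show thesis
    using density_nonneg[OF \<open>t \<in> S\<close>] k(3) by (intro that[of "\<lambda>x. f t x * k x"]) auto
qed

text \<open>The exponent allowed to the prior mass of the ball of radius \<open>2\<^sup>-\<^sup>(\<^sup>J\<^sup>-\<^sup>k\<^sup>)\<close> is measured in the scale of the testing
exponents at that radius. For \<open>\<gamma> = 4\<close> both have the same order, so the constant matters.\<close>
lemma prior_growth_rate:
  fixes \<gamma> b N :: real
  assumes \<gamma>: "1 \<le> \<gamma>" "\<gamma> \<le> 4" and b: "\<gamma> ^ 3 * b / 3 \<le> N / 4 ^ J / 4" and k: "3 \<le> k" "k \<le> J" and N: "0 \<le> N"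
  shows "\<gamma> ^ k * b \<le> 3 / 256 * (N / 4 ^ (J - k))"
proof -
  have "\<gamma> ^ k * b = \<gamma> ^ (k - 3) * (\<gamma> ^ 3 * b)"
    using k by (simp flip: power_add mult.assoc)
  also have "\<dots> \<le> \<gamma> ^ (k - 3) * (3 / 4 * (N / 4 ^ J))"
    using b \<gamma> by (intro mult_left_mono) auto
  also have "\<dots> \<le> 4 ^ (k - 3) * (3 / 4 * (N / 4 ^ J))"
    using \<gamma> N by (intro mult_right_mono power_mono) auto
  also have "\<dots> = 3 / 256 * (N / 4 ^ (J - k))"
  proof -
    have "J = (J - k) + ((k - 3) + 3)" using k by simp
    then have "(4::real) ^ J = 4 ^ (J - k) * (4 ^ (k - 3) * 4 ^ 3)" by (metis power_add)
    then show ?thesis by simp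
  qed
  finally show ?thesis .
qed

theorem theorem3:
  shows "\<exists>C::real. \<forall>(\<mu>::'x measure) (S::'s set) (f::'s \<Rightarrow> 'x \<Rightarrow> real) (\<nu>::'s measure) (s::'s)
      (D::real \<Rightarrow> real) (\<beta>::nat \<Rightarrow> real) (\<gamma>::real) (n::nat) (J::nat) (\<kappa>::real)
      (P::'x measure) (K::real) (w::real \<Rightarrow> real) (\<delta>::real) (a'::real) (B'::real)
      (est::(nat \<Rightarrow> 'x) \<Rightarrow> 's) (\<Delta>::real).
    bayes_model \<mu> S f \<nu> \<and> s \<in> S \<and>

    antimono_on {0<..1/4} D \<and> (\<forall>x\<in>{0<..1/4}. 1 \<le> D x) \<and>
    (\<forall>x\<in>{0<..1/4}. \<forall>t\<in>S. \<forall>N. N \<subseteq> hball \<mu> f S t (4 * x) \<and> separated (hdist \<mu> f) x N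
        \<longrightarrow> finite N \<and> real (card N) \<le> exp (D x)) \<and>

    mono \<beta> \<and> (\<forall>j. 1 \<le> \<beta> j) \<and> 1 \<le> \<gamma> \<and> \<gamma> \<le> 4 \<and>
    (\<forall>j k. 3 \<le> j \<and> 3 \<le> k \<and> k \<le> j \<longrightarrow>
        measure \<nu> (hball \<mu> f S s (1 / 2 ^ (j - k)))
          \<le> exp (\<gamma> ^ k * \<beta> j) * measure \<nu> (hball \<mu> f S s (1 / 2 ^ j))) \<and>

    3 \<le> J \<and> 1 < \<kappa> \<and>
    4 powi (- int J - 1) * real n \<ge> Max {\<gamma> ^ 3 * \<beta> J / 3, D (2 powi (1 - int J)), \<kappa>} \<and>

    prob_space P \<and> sets P = sets \<mu> \<and> 0 \<le> K \<and>
    1 / emeasure \<nu> (hball \<mu> f S s (1 / 2 ^ J))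
        * (\<integral>\<^sup>+ t \<in> hball \<mu> f S s (1 / 2 ^ J). kullback P (model_dist \<mu> f t) \<partial>\<nu>) = ennreal K \<and>

    w \<in> borel_measurable (restrict_space borel {0..1}) \<and> (\<exists>z\<in>{0..1}. w z \<noteq> 0) \<and>
    0 < \<delta> \<and> 0 < a' \<and> 0 < B' \<and> B' \<le> (\<kappa> - 1) / 4 \<and> w 0 = 0 \<and>
    (\<forall>z\<in>{0<..1/2}. \<forall>x. 2 \<le> x \<and> x \<le> 1 / z \<longrightarrow>
        x powr \<delta> * w z \<le> w (x * z) \<and> w (x * z) \<le> a' * exp (B' * x\<^sup>2) * w z) \<and>

    bayes_estimator \<mu> S f \<nu> w P n est \<and>
    \<Delta> = 4 * ((5 / 4 * (1 + a' / 2)) powr (1 / \<delta>) + 1)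
    \<longrightarrow>
    (\<integral>x. (hdist \<mu> f (est x) s)\<^sup>2 \<partial>Pi\<^sub>M {..<n} (\<lambda>_. P)) \<le> C * \<Delta>\<^sup>2 * (4 powi (- int J) + K)"
proof (intro exI[of _ 1056] allI impI, elim conjE)
  fix \<mu> :: "'x measure" and S :: "'s set" and f :: "'s \<Rightarrow> 'x \<Rightarrow> real" and \<nu> :: "'s measure"
    and s :: 's and D :: "real \<Rightarrow> real" and \<beta> :: "nat \<Rightarrow> real" and \<gamma> :: real and n J :: nat
    and \<kappa> :: real and P :: "'x measure" and K :: real and w :: "real \<Rightarrow> real" and \<delta> a' B' :: real
    and est :: "(nat \<Rightarrow> 'x) \<Rightarrow> 's" and \<Delta> :: real
  assume model: "bayes_model \<mu> S f \<nu>" and s: "s \<in> S"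
    and D: "antimono_on {0<..1/4} D" "\<forall>x\<in>{0<..1/4}. 1 \<le> D x"
    and cov: "\<forall>x\<in>{0<..1/4}. \<forall>t\<in>S. \<forall>N. N \<subseteq> hball \<mu> f S t (4 * x) \<and> separated (hdist \<mu> f) x N
        \<longrightarrow> finite N \<and> real (card N) \<le> exp (D x)"
    and \<beta>: "mono \<beta>" "\<forall>j. 1 \<le> \<beta> j" and \<gamma>: "1 \<le> \<gamma>" "\<gamma> \<le> 4"
    and prior: "\<forall>j k. 3 \<le> j \<and> 3 \<le> k \<and> k \<le> j \<longrightarrow>
        measure \<nu> (hball \<mu> f S s (1 / 2 ^ (j - k)))
          \<le> exp (\<gamma> ^ k * \<beta> j) * measure \<nu> (hball \<mu> f S s (1 / 2 ^ j))"
    and J: "3 \<le> J" and \<kappa>: "1 < \<kappa>"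
    and size: "4 powi (- int J - 1) * real n \<ge> Max {\<gamma> ^ 3 * \<beta> J / 3, D (2 powi (1 - int J)), \<kappa>}"
    and P: "prob_space P" "sets P = sets \<mu>" and K: "0 \<le> K"
    and kull: "1 / emeasure \<nu> (hball \<mu> f S s (1 / 2 ^ J))
        * (\<integral>\<^sup>+ t \<in> hball \<mu> f S s (1 / 2 ^ J). kullback P (model_dist \<mu> f t) \<partial>\<nu>) = ennreal K"
    and w: "w \<in> borel_measurable (restrict_space borel {0..1})" "\<exists>z\<in>{0..1}. w z \<noteq> 0"
    and pos: "0 < \<delta>" "0 < a'" "0 < B'" and B': "B' \<le> (\<kappa> - 1) / 4" and w0: "w 0 = 0"
    and growth: "\<forall>z\<in>{0<..1/2}. \<forall>x. 2 \<le> x \<and> x \<le> 1 / z \<longrightarrow>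
        x powr \<delta> * w z \<le> w (x * z) \<and> w (x * z) \<le> a' * exp (B' * x\<^sup>2) * w z"
    and bayes: "bayes_estimator \<mu> S f \<nu> w P n est"
    and \<Delta>: "\<Delta> = 4 * ((5 / 4 * (1 + a' / 2)) powr (1 / \<delta>) + 1)"
  interpret bayes_model \<mu> S f \<nu> by fact
  interpret nu: prob_space \<nu> by (rule prob_prior)
  let ?B = "hball \<mu> f S s (1 / 2 ^ J)"
  define N where "N = real n"
  have e4: "4 powi (- int J - 1) * real n = N / 4 ^ J / 4"
    by (simp add: N_def power_int_diff power_int_minus field_simps)
  have e2: "2 powi (1 - int J) = (2::real) / 2 ^ J"
    by (simp add: power_int_diff)
  from size have size3: "\<gamma> ^ 3 * \<beta> J / 3 \<le> N / 4 ^ J / 4" "D (2 / 2 ^ J) \<le> N / 4 ^ J / 4" "\<kappa> \<le> N / 4 ^ J / 4"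
    unfolding e4 e2 by simp_all
  have "1 \<le> N / 4 ^ J / 4" by (rule order_trans[OF less_imp_le[OF \<kappa>] size3(3)])
  then have n_large: "4 * 4 ^ J \<le> N" by (simp add: field_simps)
  have prior_growth: "measure \<nu> (hball \<mu> f S s (1 / 2 ^ i))
      \<le> exp (3 / 256 * (n / 4 ^ i)) * measure \<nu> ?B" if "i + 3 \<le> J" for i
  proof -
    have "measure \<nu> (hball \<mu> f S s (1 / 2 ^ i)) \<le> exp (\<gamma> ^ (J - i) * \<beta> J) * measure \<nu> ?B"
      using prior[rule_format, of J "J - i"] that by simp
    also have "\<dots> \<le> exp (3 / 256 * (n / 4 ^ i)) * measure \<nu> ?B"
      using prior_growth_rate[OF \<gamma> size3(1), of "J - i"] that
      by (intro mult_right_mono) (auto simp: N_def)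
    finally show ?thesis .
  qed
  \<comment> \<open>The ball of radius 1 is the whole parameter set, so the prior growth condition keeps the mass of the small
    ball away from 0; otherwise the average divergence would be \<open>\<infinity> * 0 = 0\<close>.\<close>
  have "hball \<mu> f S s (1 / 2 ^ 0) = space \<nu>"
    using h_le_1[OF s] sets_eq_imp_space_eq[OF sets_prior] by (auto simp: hball_eq s space_hborel)
  then have "1 \<le> exp (3 / 256 * (n / 4 ^ 0)) * measure \<nu> ?B"
    using prior_growth[of 0] J nu.prob_space by simp
  then have prior_pos: "0 < measure \<nu> ?B"
    by (cases "measure \<nu> ?B = 0") (auto simp: less_le)
  \<comment> \<open>A parameter of finite divergence dominates \<open>P\<close>, and so gives the density of \<open>P\<close> on which
    the comparison of likelihoods rests.\<close>
  have "\<exists>t\<in>?B. kullback P (model_dist \<mu> f t) \<noteq> \<infinity>"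
  proof (rule ccontr)
    assume "\<not> (\<exists>t\<in>?B. kullback P (model_dist \<mu> f t) \<noteq> \<infinity>)"
    then have "(\<integral>\<^sup>+ t \<in> ?B. kullback P (model_dist \<mu> f t) \<partial>\<nu>) = (\<integral>\<^sup>+ t \<in> ?B. \<infinity> \<partial>\<nu>)"
      by (intro nn_integral_cong) (auto split: split_indicator)
    also have "\<dots> = \<infinity>"
    proof -
      have "?B \<in> sets \<nu>" using prior_pos measure_notin_sets by fastforce
      then have "(\<integral>\<^sup>+ t \<in> ?B. \<infinity> \<partial>\<nu>) = \<infinity> * emeasure \<nu> ?B" by (rule nn_integral_cmult_indicator)
      then show ?thesis using prior_pos by (simp add: nu.emeasure_eq_measure ennreal_top_mult)
    qed
    finally have "1 / emeasure \<nu> ?B * \<infinity> = ennreal K" using kull by simp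
    moreover have "1 / emeasure \<nu> ?B \<noteq> 0"
      using nu.emeasure_finite by (simp add: ennreal_divide_eq_0_iff)
    ultimately show False by (simp add: ennreal_mult_top)
  qed
  then obtain t where t: "t \<in> ?B" "kullback P (model_dist \<mu> f t) \<noteq> \<infinity>" by blast
  then have "t \<in> S" "absolutely_continuous (model_dist \<mu> f t) P"
    by (auto simp: hball_eq s kullback_def split: if_splits)
  with density_of_absolutely_continuous[OF model P]
  obtain p where p: "p \<in> borel_measurable \<mu>" "\<And>x. x \<in> space \<mu> \<Longrightarrow> 0 \<le> p x"
    "P = density \<mu> (\<lambda>x. ennreal (p x))" by blast
  have cov': "\<And>x t N. x \<in> {0<..1/4} \<Longrightarrow> t \<in> S \<Longrightarrow> N \<subseteq> hball \<mu> f S t (4 * x) \<Longrightarrow>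
      separated (hdist \<mu> f) x N \<Longrightarrow> finite N \<and> real (card N) \<le> exp (D x)"
    using cov by blast
  have growth': "\<And>z x. z \<in> {0<..1/2} \<Longrightarrow> 2 \<le> x \<Longrightarrow> x \<le> 1 / z \<Longrightarrow>
      x powr \<delta> * w z \<le> w (x * z) \<and> w (x * z) \<le> a' * exp (B' * x\<^sup>2) * w z"
    using growth by blast
  interpret P: prob_space P by (rule P(1))
  interpret E: bayes_experiment \<mu> S f \<nu> P p n w \<delta> a' B' s D J est
  proof unfold_locales
    fix i assume i: "i + 6 \<le> J"
    have D_le: "D x \<le> N / 4 ^ J / 4" if "2 / 2 ^ J \<le> x" "x \<le> 1 / 4" for x
    proof -
      have "(2::real) ^ 3 \<le> 2 ^ J" using J by (intro power_increasing) auto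
      then have "2 / 2 ^ J \<in> {0<..1/4::real}" by (simp add: field_simps)
      moreover have "0 < x" using that(1) by (rule less_le_trans[rotated]) simp
      ultimately have "D x \<le> D (2 / 2 ^ J)"
        using monotone_onD[OF D(1), of "2 / 2 ^ J" x] that by simp
      then show ?thesis using size3(2) by linarith
    qed
    have "(2::real) ^ (i + 5) \<le> 2 ^ J" using i by (intro power_increasing) auto
    then have lo: "2 / 2 ^ J \<le> 1 / 2 ^ i / (16::real)" by (simp add: power_add field_simps)
    have mid: "1 / 2 ^ i / 16 \<le> 1 / 2 ^ i / (4::real)" and hi: "1 / 2 ^ i / 4 \<le> 1 / (4::real)"
      by (simp_all add: divide_simps)
    have "D (1 / 2 ^ i / 16) \<le> N / 4 ^ J / 4"
      by (rule D_le[OF lo order_trans[OF mid hi]])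
    moreover have "D (1 / 2 ^ i / 4) \<le> N / 4 ^ J / 4"
      by (rule D_le[OF order_trans[OF lo mid] hi])
    ultimately have "D (1 / 2 ^ i / 4) + D (1 / 2 ^ i / 16) \<le> N / 4 ^ J / 4 + N / 4 ^ J / 4"
      by (rule add_mono[rotated])
    then show "D (1 / 2 ^ i / 4) + D (1 / 2 ^ i / 16) \<le> real n / 4 ^ J / 2"
      by (simp add: N_def field_simps)
    show "measure \<nu> (hball \<mu> f S s (1 / 2 ^ i)) \<le> exp (3 / 256 * (real n / 4 ^ i)) * measure \<nu> ?B"
      using i by (intro prior_growth) simp
  next
    have "B' \<le> \<kappa> / 4" by (rule order_trans[OF B']) simp
    also have "\<dots> \<le> N / 4 ^ J / 4 / 4" using size3(3) by (rule divide_right_mono) simp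
    finally show "B' \<le> real n / 4 ^ J / 16" by (simp add: N_def)
  qed (fact p pos w w0 growth' s cov' prior_pos n_large[unfolded N_def] bayes)+
  have "E.\<Delta> = \<Delta>" by (simp add: E.\<Delta>_def \<Delta>)
  moreover have "(\<integral>x. (hdist \<mu> f (est x) s)\<^sup>2 \<partial>Pi\<^sub>M {..<n} (\<lambda>_. P)) \<le> 1056 * E.\<Delta>\<^sup>2 * (1 / 4 ^ J + K)"
    using K kull unfolding E.core_def[symmetric] by (rule E.bayes_risk_bound)
  moreover have "4 powi (- int J) = (1::real) / 4 ^ J" by (simp add: power_int_minus field_simps)
  ultimately show "(\<integral>x. (hdist \<mu> f (est x) s)\<^sup>2 \<partial>Pi\<^sub>M {..<n} (\<lambda>_. P)) \<le> 1056 * \<Delta>\<^sup>2 * (4 powi (- int J) + K)"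
    by simp
qed

end
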